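(* For any signature $\Sigma$, the kernel $\ker r_{A_l(\Sigma)}$ is a Hopf ideal of $\mathbf N(T(\Sigma))$, and the linear map $\phi:\mathbf N(T(\Sigma))/\ker r_{A_l(\Sigma)}\to\mathbf{NCK}(\Sigma)$ determined by $\phi(\pi(E_f))=E_{\mathrm{tr}(f)}$ for every reduced $\Sigma$-forest $f$ (where $\pi$ is the quotient map) is a well-defined Hopf algebra isomorphism.
   Context: $\mathbb K$ is a field of characteristic zero; $[P]$ is $1$ if $P$ holds, $0$ otherwise. A signature is a set $\Sigma$ with arity map $|\cdot|:\Sigma\to\mathbb N$. A $\Sigma$-term is the leaf $\bot$ or $s(t_1,\dots,t_n)$ with $s$ of arity $n$, $t_i$ terms; degree = number of internal nodes, arity $|t|$ = number of leaves. $T(\Sigma)$: free operad, $t[t_1,\dots,t_{|t|}]$ grafting $t_i$ on the $i$-th leaf. A $\Sigma$-forest is a finite word of terms; reduced if no term is $\bot$; $\mathrm{rd}$ deletes terms equal to $\bot$. $\mathbf N(T(\Sigma))$: basis $E_f$ ($f$ reduced forest), product $E_{f_1}E_{f_2}=E_{f_1f_2}$, coproduct the algebra morphism with $\Delta E_t=\sum E_{\mathrm{rd}(t')}\otimes E_{\mathrm{rd}(t_1\cdots t_{|t'|})}$ over all $t',t_1,\dots$ with $t=t'[t_1,\dots,t_{|t'|}]$. Nodes of a forest $f$ are numbered $1,\dots,\deg f$ by preorder; $d_f(i)$ is the decoration of $i$. $A_l(\Sigma)=\{a^s_\ell:s\in\Sigma,\ell\in\mathbb N\}$; a word $a^{s_1}_{\ell_1}\cdots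 a^{s_n}_{\ell_n}$ is $A_l(\Sigma)$-compatible with $f$ if $n=\deg f$, $s_i=d_f(i)$, and $\ell_i<\ell_{i'}$ whenever $i'$ is a child of $i$; $r_{A_l(\Sigma)}:\mathbf N(T(\Sigma))\to\mathbb K\langle A_l(\Sigma)\rangle$ is the linear map sending $E_f$ to the sum of all such compatible words. A $\Sigma$-trimmed forest is a word of nonempty planar rooted trees whose nodes are decorated by elements $s\in\Sigma$ and have at most $|s|$ children; $\mathrm{tr}(f)$ deletes the leaves of a forest $f$. Nodes of a trimmed forest $F$ are numbered $1,\dots,n$ by left-to-right preorder. For $I\subseteq[n]$, $F(I)$ is the trimmed forest formed by the nodes in $I$ and the edges of $F$ between them (each node in $I$ whose parent is not in $I$ becoming a root), trees ordered by preorder of roots and children in their original relative order. $(I_1,I_2)$ is $F$-admissible if $I_1\sqcup I_2=[n]$, $I_1$ is closed under ancestors and $I_2$ under descendants. $\mathbf{NCK}(\Sigma)$ is the vector space with basis $E_F$ indexed by $\Sigma$-trimmed forests, product $E_{F_1}E_{F_2}=E_{F_1F_2}$ (concatenation) and coproduct $\Delta E_F=\sum_{I_1,I_2}[(I_1,I_2)\ F\text{-admissible}]\,E_{F(I_1)}\otimes E_{F(I_2)}$. *)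

theory Defs
  imports Main
begin

text \<open>A signature is a set S of symbols together with an arity map ar.
  Bot is the leaf; Node s ts is s(t_1,...,t_n).\<close>

datatype 's trm = Bot | Node 's "'s trm list"

fun wf_trm :: "'s set \<Rightarrow> ('s \<Rightarrow> nat) \<Rightarrow> 's trm \<Rightarrow> bool" where
  "wf_trm S ar Bot = True"
| "wf_trm S ar (Node s ts) = (s \<in> S \<and> length ts = ar s \<and> (\<forall>t\<in>set ts. wf_trm S ar t))"

fun deg :: "'s trm \<Rightarrow> nat" where
  "deg Bot = 0"
| "deg (Node s ts) = Suc (sum_list (map deg ts))"

fun nleaves :: "'s trm \<Rightarrow> nat" where
  "nleaves Bot = 1"
| "nleaves (Node s ts) = sum_list (map nleaves ts)"

text \<open>Grafting: graftL t xs replaces the leaves of t, from left to right, by the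
  successive elements of xs and returns the unused rest of xs.\<close>
fun graftL :: "'s trm \<Rightarrow> 's trm list \<Rightarrow> 's trm \<times> 's trm list"
and graftsL :: "'s trm list \<Rightarrow> 's trm list \<Rightarrow> 's trm list \<times> 's trm list" where
  "graftL Bot [] = (Bot, [])"
| "graftL Bot (x # xs) = (x, xs)"
| "graftL (Node s ts) xs = (let (ts', ys) = graftsL ts xs in (Node s ts', ys))"
| "graftsL [] xs = ([], xs)"
| "graftsL (t # ts) xs = (let (t', ys) = graftL t xs; (ts', zs) = graftsL ts ys in (t' # ts', zs))"

definition graft :: "'s trm \<Rightarrow> 's trm list \<Rightarrow> 's trm" where
  "graft t xs = fst (graftL t xs)"

definition rd :: "'s trm list \<Rightarrow> 's trm list" where
  "rd f = filter (\<lambda>t. t \<noteq> Bot) f"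

definition decomps :: "'s set \<Rightarrow> ('s \<Rightarrow> nat) \<Rightarrow> 's trm \<Rightarrow> ('s trm \<times> 's trm list) set" where
  "decomps S ar t = {(t', ts). wf_trm S ar t' \<and> length ts = nleaves t' \<and>
       (\<forall>u\<in>set ts. wf_trm S ar u) \<and> graft t' ts = t}"

section \<open>Preorder numbering of nodes (0-based)\<close>

fun labsT :: "'s trm \<Rightarrow> 's list" where
  "labsT Bot = []"
| "labsT (Node s ts) = s # concat (map labsT ts)"

definition labsF :: "'s trm list \<Rightarrow> 's list" where
  "labsF f = concat (map labsT f)"

definition degF :: "'s trm list \<Rightarrow> nat" where
  "degF f = sum_list (map deg f)"

text \<open>Parent-child edges (i, j): node j is a child of node i, where the
  root of the given term has number k.\<close>
fun edgesT :: "nat \<Rightarrow> 's trm \<Rightarrow> (nat \<times> nat) set"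
and edgesL :: "nat \<Rightarrow> nat \<Rightarrow> 's trm list \<Rightarrow> (nat \<times> nat) set" where
  "edgesT k Bot = {}"
| "edgesT k (Node s ts) = edgesL k (Suc k) ts"
| "edgesL p k [] = {}"
| "edgesL p k (t # ts) = (if t = Bot then {} else {(p, k)}) \<union> edgesT k t \<union> edgesL p (k + deg t) ts"

fun edgesF :: "nat \<Rightarrow> 's trm list \<Rightarrow> (nat \<times> nat) set" where
  "edgesF k [] = {}"
| "edgesF k (t # f) = edgesT k t \<union> edgesF (k + deg t) f"

text \<open>A Sigma-trimmed tree is represented as a term without any leaf Bot,
  each node s having at most ar s children.\<close>
fun trim_wf :: "'s set \<Rightarrow> ('s \<Rightarrow> nat) \<Rightarrow> 's trm \<Rightarrow> bool" where
  "trim_wf S ar Bot = False"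
| "trim_wf S ar (Node s ts) = (s \<in> S \<and> length ts \<le> ar s \<and> (\<forall>t\<in>set ts. trim_wf S ar t))"

fun trT :: "'s trm \<Rightarrow> 's trm list" where
  "trT Bot = []"
| "trT (Node s ts) = [Node s (concat (map trT ts))]"

definition trF :: "'s trm list \<Rightarrow> 's trm list" where
  "trF f = concat (map trT f)"

text \<open>Restriction F(I).  restrT I k T (root of T numbered k) returns the list of
  trees of T(I) in preorder of their roots; if k is in I the first of them is
  the tree rooted at the root of T.\<close>
fun restrT :: "nat set \<Rightarrow> nat \<Rightarrow> 's trm \<Rightarrow> 's trm list"
and restrL :: "nat set \<Rightarrow> nat \<Rightarrow> 's trm list \<Rightarrow> (bool \<times> 's trm list) list" where
  "restrT I k Bot = []"
| "restrT I k (Node s ts) = (let rs = restrL I (Suc k) ts in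
     if k \<in> I then Node s (map (hd \<circ> snd) (filter fst rs)) # concat (map (\<lambda>(b, r). if b then tl r else r) rs)
     else concat (map snd rs))"
| "restrL I k [] = []"
| "restrL I k (t # ts) = (k \<in> I \<and> t \<noteq> Bot, restrT I k t) # restrL I (k + deg t) ts"

fun restrF :: "nat set \<Rightarrow> nat \<Rightarrow> 's trm list \<Rightarrow> 's trm list" where
  "restrF I k [] = []"
| "restrF I k (t # f) = restrT I k t @ restrF I (k + deg t) f"

definition admissible :: "'s trm list \<Rightarrow> nat set \<Rightarrow> nat set \<Rightarrow> bool" where
  "admissible F I1 I2 \<longleftrightarrow> I1 \<inter> I2 = {} \<and> I1 \<union> I2 = {..<degF F} \<and>
     (\<forall>(i, j)\<in>(edgesF 0 F)\<^sup>+. j \<in> I1 \<longrightarrow> i \<in> I1) \<and>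
     (\<forall>(i, j)\<in>(edgesF 0 F)\<^sup>+. i \<in> I2 \<longrightarrow> j \<in> I2)"

text \<open>Vectors of the vector space with basis indexed by 'a are finitely supported
  coefficient functions 'a \<Rightarrow> 'k.\<close>

definition vsupp :: "('a \<Rightarrow> 'k::zero) \<Rightarrow> 'a set" where
  "vsupp v = {x. v x \<noteq> 0}"

definition bvec :: "'a \<Rightarrow> 'a \<Rightarrow> 'k::{zero,one}" where
  "bvec x = (\<lambda>y. if y = x then 1 else 0)"

definition lext :: "('a \<Rightarrow> 'b \<Rightarrow> 'k::comm_semiring_1) \<Rightarrow> ('a \<Rightarrow> 'k) \<Rightarrow> 'b \<Rightarrow> 'k" where
  "lext g v = (\<lambda>y. \<Sum>x\<in>vsupp v. v x * g x y)"

definition vspace :: "('a \<Rightarrow> bool) \<Rightarrow> ('a \<Rightarrow> 'k::zero) set" where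
  "vspace B = {v. finite (vsupp v) \<and> (\<forall>x\<in>vsupp v. B x)}"

definition cat_mul :: "('a list \<Rightarrow> 'k::comm_semiring_1) \<Rightarrow> ('a list \<Rightarrow> 'k) \<Rightarrow> 'a list \<Rightarrow> 'k" where
  "cat_mul u v = lext (\<lambda>a. lext (\<lambda>b. bvec (a @ b)) v) u"

definition tens_mul :: "('a list \<times> 'a list \<Rightarrow> 'k::comm_semiring_1) \<Rightarrow> ('a list \<times> 'a list \<Rightarrow> 'k)
     \<Rightarrow> 'a list \<times> 'a list \<Rightarrow> 'k" where
  "tens_mul T U = lext (\<lambda>(a1, a2). lext (\<lambda>(b1, b2). bvec (a1 @ b1, a2 @ b2)) U) T"

definition tensor :: "('a \<Rightarrow> 'k::times) \<Rightarrow> ('b \<Rightarrow> 'k) \<Rightarrow> 'a \<times> 'b \<Rightarrow> 'k" where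
  "tensor a b = (\<lambda>(x, y). a x * b y)"

definition in_span :: "('a \<Rightarrow> 'k::comm_semiring_1) set \<Rightarrow> ('a \<Rightarrow> 'k) \<Rightarrow> bool" where
  "in_span A v \<longleftrightarrow> (\<exists>(n::nat) c g. (\<forall>i<n. g i \<in> A) \<and> v = (\<lambda>x. \<Sum>i<n. c i * g i x))"

text \<open>Antipode of the bialgebra with basis {E_f | B f} (free algebra under
  concatenation, counit E_f \<mapsto> [f = []]) and coproduct cop on basis vectors.
  Sb f is the image of E_f.\<close>
definition is_antipode :: "('a list \<Rightarrow> bool) \<Rightarrow> ('a list \<Rightarrow> 'a list \<times> 'a list \<Rightarrow> 'k::comm_ring_1)
    \<Rightarrow> ('a list \<Rightarrow> 'a list \<Rightarrow> 'k) \<Rightarrow> bool" where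
  "is_antipode B cop Sb \<longleftrightarrow> (\<forall>f. B f \<longrightarrow> Sb f \<in> vspace B \<and>
     lext (\<lambda>(f1, f2). cat_mul (Sb f1) (bvec f2)) (cop f) = (if f = [] then bvec [] else (\<lambda>_. 0)) \<and>
     lext (\<lambda>(f1, f2). cat_mul (bvec f1) (Sb f2)) (cop f) = (if f = [] then bvec [] else (\<lambda>_. 0)))"

definition hopf_ideal :: "('a list \<Rightarrow> bool) \<Rightarrow> ('a list \<Rightarrow> 'a list \<times> 'a list \<Rightarrow> 'k::comm_ring_1)
    \<Rightarrow> ('a list \<Rightarrow> 'k) set \<Rightarrow> bool" where
  "hopf_ideal B cop I \<longleftrightarrow>
     I \<subseteq> vspace B \<and> (\<lambda>_. 0) \<in> I \<and>
     (\<forall>x\<in>I. \<forall>y\<in>I. (\<lambda>z. x z + y z) \<in> I) \<and> (\<forall>c. \<forall>x\<in>I. (\<lambda>z. c * x z) \<in> I) \<and>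
     (\<forall>a\<in>vspace B. \<forall>x\<in>I. cat_mul a x \<in> I \<and> cat_mul x a \<in> I) \<and>
     (\<forall>x\<in>I. x [] = 0) \<and>
     (\<forall>x\<in>I. in_span ({tensor a b |a b. a \<in> I \<and> b \<in> vspace B} \<union> {tensor a b |a b. a \<in> vspace B \<and> b \<in> I})
                    (lext cop x)) \<and>
     (\<exists>Sb. is_antipode B cop Sb) \<and>
     (\<forall>Sb. is_antipode B cop Sb \<longrightarrow> (\<forall>x\<in>I. lext Sb x \<in> I))"

definition N_basis :: "'s set \<Rightarrow> ('s \<Rightarrow> nat) \<Rightarrow> 's trm list \<Rightarrow> bool" where
  "N_basis S ar f \<longleftrightarrow> (\<forall>t\<in>set f. t \<noteq> Bot \<and> wf_trm S ar t)"

definition copT :: "'s set \<Rightarrow> ('s \<Rightarrow> nat) \<Rightarrow> 's trm \<Rightarrow> 's trm list \<times> 's trm list \<Rightarrow> 'k::comm_semiring_1" where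
  "copT S ar t = (\<lambda>(x, y). of_nat (card {(t', ts). (t', ts) \<in> decomps S ar t \<and> rd [t'] = x \<and> rd ts = y}))"

fun copN :: "'s set \<Rightarrow> ('s \<Rightarrow> nat) \<Rightarrow> 's trm list \<Rightarrow> 's trm list \<times> 's trm list \<Rightarrow> 'k::comm_semiring_1" where
  "copN S ar [] = bvec ([], [])"
| "copN S ar (t # f) = tens_mul (copT S ar t) (copN S ar f)"

definition K_basis :: "'s set \<Rightarrow> ('s \<Rightarrow> nat) \<Rightarrow> 's trm list \<Rightarrow> bool" where
  "K_basis S ar F \<longleftrightarrow> (\<forall>t\<in>set F. trim_wf S ar t)"

definition copK :: "'s trm list \<Rightarrow> 's trm list \<times> 's trm list \<Rightarrow> 'k::comm_semiring_1" where
  "copK F = (\<lambda>(x, y). of_nat (card {(I1, I2). admissible F I1 I2 \<and> restrF I1 0 F = x \<and> restrF I2 0 F = y}))"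

text \<open>The letter a^s_l is the pair (s, l); words are lists of letters.  Since
  r(E_f) is in general an infinite sum of words, its values are formal series,
  i.e. coefficient functions on words.\<close>
definition compat :: "'s trm list \<Rightarrow> ('s \<times> nat) list \<Rightarrow> bool" where
  "compat f w \<longleftrightarrow> length w = degF f \<and> (\<forall>i<length w. fst (w ! i) = labsF f ! i) \<and>
     (\<forall>(i, j)\<in>edgesF 0 f. snd (w ! i) < snd (w ! j))"

definition rmap :: "('s trm list \<Rightarrow> 'k::comm_semiring_1) \<Rightarrow> ('s \<times> nat) list \<Rightarrow> 'k" where
  "rmap v = lext (\<lambda>f w. if compat f w then 1 else 0) v"

definition kerR :: "'s set \<Rightarrow> ('s \<Rightarrow> nat) \<Rightarrow> ('s trm list \<Rightarrow> 'k::comm_semiring_1) set" where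
  "kerR S ar = {v \<in> vspace (N_basis S ar). rmap v = (\<lambda>_. 0)}"

text \<open>The linear map E_f \<mapsto> E_{tr(f)}, i.e. \<phi> \<circ> \<pi>.\<close>
definition Psi :: "('s trm list \<Rightarrow> 'k::comm_semiring_1) \<Rightarrow> 's trm list \<Rightarrow> 'k" where
  "Psi v = lext (\<lambda>f. bvec (trF f)) v"

end

theory Submission
  imports Defs
begin

text \<open>Compatibility of a word with a forest only involves internal nodes, so the realization factors
  through trimming. Among the words compatible with a trimmed forest there is a pointwise least one,
  labelling each node by its depth; it determines the forest, so by triangularity the
  realization is injective on trimmed forests. Hence the kernel of the realization is that of
  the trimming map \<open>E\<^sub>f \<mapsto> E\<^bsub>tr(f)\<^esub>\<close>. Decomposing a term as \<open>t = t'[t\<^sub>1, \<dots>, t\<^sub>n]\<close> amounts to choosing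
  an ancestor-closed set of nodes, so trimming commutes with the coproducts. Both bialgebras are graded
  and connected, so their antipodes exist by Takeuchi's formula, are unique, and are
  compatible with trimming.\<close>

section \<open>Finitely supported vectors\<close>

text \<open>The realization is only a linear map into formal series, so the coideal and antipode
  conditions on \<open>kerR\<close> cannot be read off \<open>rmap\<close> itself; they are
  transported along trimming, whose target is a bialgebra. The obstacle is that both coproducts
  count by cardinalities, of grafting decompositions for terms and of admissible pairs for trimmed
  forests, and neither form supports induction. Both are therefore rewritten as sums over lists of
  cuts defined by structural recursion. Repetition in a list records the multiplicity of a summand,
  so that the counit axioms and the compatibility of trimming with the coproducts become equalities
  of lists, and coassociativity an equality of list sums. Deleting leaves too early would destroy
  the arities of nodes in the upper parts; hence leaves are kept there during the recursion, and
  reduction or trimming is applied at the end.\<close>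

lemma lext_superset:
  assumes "finite A" "vsupp v \<subseteq> A"
  shows "lext g v y = (\<Sum>x\<in>A. v x * g x y)"
  unfolding lext_def using assms
  by (intro sum.mono_neutral_left) (auto simp: vsupp_def)

lemma vsupp_bvec: "vsupp (bvec x :: 'a \<Rightarrow> 'k::comm_ring_1) \<subseteq> {x}"
  by (auto simp: vsupp_def bvec_def)

lemma finite_vsupp_bvec [simp]: "finite (vsupp (bvec x :: 'a \<Rightarrow> 'k::comm_ring_1))"
  by (rule finite_subset[OF vsupp_bvec]) simp

lemma lext_bvec [simp]: "lext g (bvec x :: 'a \<Rightarrow> 'k::comm_ring_1) = g x"
  by (rule ext, subst lext_superset[of "{x}"]) (auto simp: vsupp_def bvec_def)

lemma lext_zero [simp]: "lext g (\<lambda>_. 0) = (\<lambda>_. 0)"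
  by (simp add: lext_def vsupp_def)

text \<open>\<open>lext\<close> sums over the support of its argument, which may shrink when
  coefficients cancel; all three sums are moved to the union of the two supports, where the identity
  is termwise.\<close>

lemma lext_add:
  assumes "finite (vsupp u)" "finite (vsupp v)"
  shows "lext g (\<lambda>x. u x + v x) y = lext g u y + lext g v y"
proof -
  have "vsupp (\<lambda>x. u x + v x) \<subseteq> vsupp u \<union> vsupp v"
    by (auto simp: vsupp_def)
  then show ?thesis using assms
    by (subst (1 2 3) lext_superset[of "vsupp u \<union> vsupp v"]) (auto simp: sum.distrib algebra_simps)
qed

lemma lext_scale:
  assumes "finite (vsupp v)"
  shows "lext g (\<lambda>x. c * v x) y = c * lext g v y"
proof -
  have "vsupp (\<lambda>x. c * v x) \<subseteq> vsupp v"
    by (auto simp: vsupp_def)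
  then show ?thesis using assms
    by (subst (1 2) lext_superset[of "vsupp v"]) (auto simp: sum_distrib_left algebra_simps)
qed

lemma lext_sum:
  assumes "finite A" "\<And>x. x \<in> A \<Longrightarrow> finite (vsupp (h x))"
  shows "finite (vsupp (\<lambda>y. \<Sum>x\<in>A. k x * h x y))"
    and "lext g (\<lambda>y. \<Sum>x\<in>A. k x * h x y) z = (\<Sum>x\<in>A. k x * lext g (h x) z)"
proof -
  have sub: "vsupp (\<lambda>y. \<Sum>x\<in>A. k x * h x y) \<subseteq> (\<Union>x\<in>A. vsupp (h x))"
  proof
    fix y assume "y \<in> vsupp (\<lambda>y. \<Sum>x\<in>A. k x * h x y)"
    then obtain x where "x \<in> A" "k x * h x y \<noteq> 0"
      unfolding vsupp_def using sum.not_neutral_contains_not_neutral by blast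
    then have "x \<in> A" "y \<in> vsupp (h x)"
      by (auto simp: vsupp_def)
    then show "y \<in> (\<Union>x\<in>A. vsupp (h x))"
      by blast
  qed
  have fin: "finite (\<Union>x\<in>A. vsupp (h x))"
    using assms by blast
  show "finite (vsupp (\<lambda>y. \<Sum>x\<in>A. k x * h x y))"
    using sub fin by (rule finite_subset)
  have "lext g (\<lambda>y. \<Sum>x\<in>A. k x * h x y) z
      = (\<Sum>y\<in>(\<Union>x\<in>A. vsupp (h x)). (\<Sum>x\<in>A. k x * h x y) * g y z)"
    by (rule lext_superset[OF fin sub])
  also have "\<dots> = (\<Sum>y\<in>(\<Union>x\<in>A. vsupp (h x)). \<Sum>x\<in>A. k x * (h x y * g y z))"
    by (simp add: sum_distrib_right mult.assoc)
  also have "\<dots> = (\<Sum>x\<in>A. k x * (\<Sum>y\<in>(\<Union>x\<in>A. vsupp (h x)). h x y * g y z))"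
    by (subst sum.swap) (simp add: sum_distrib_left)
  also have "\<dots> = (\<Sum>x\<in>A. k x * lext g (h x) z)"
    using fin by (intro sum.cong refl arg_cong2[of _ _ _ _ "(*)"] lext_superset[symmetric]) auto
  finally show "lext g (\<lambda>y. \<Sum>x\<in>A. k x * h x y) z = (\<Sum>x\<in>A. k x * lext g (h x) z)" .
qed

lemma lext_lext:
  assumes "finite (vsupp v)" "\<And>x. x \<in> vsupp v \<Longrightarrow> finite (vsupp (h x))"
  shows "lext g (lext h v) = lext (\<lambda>x. lext g (h x)) v"
  unfolding lext_def[of h] by (rule ext, subst lext_sum(2)[OF assms]) (simp_all add: lext_def[of "\<lambda>x. lext g (h x)"])

lemma finite_vsupp_lext:
  assumes "finite (vsupp v)" "\<And>x. x \<in> vsupp v \<Longrightarrow> finite (vsupp (h x))"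
  shows "finite (vsupp (lext h v))"
  using lext_sum(1)[OF assms] by (simp add: lext_def)

lemma lext_cong:
  "(\<And>x. x \<in> vsupp v \<Longrightarrow> g x = h x) \<Longrightarrow> lext g v = lext h v"
  by (auto simp: lext_def)

lemma vspaceD: "v \<in> vspace B \<Longrightarrow> finite (vsupp v)" "v \<in> vspace B \<Longrightarrow> x \<in> vsupp v \<Longrightarrow> B x"
  by (auto simp: vspace_def)

lemma vspace_nonzero: "v \<in> vspace B \<Longrightarrow> v x \<noteq> 0 \<Longrightarrow> B x"
  by (auto simp: vspace_def vsupp_def)

lemma vspaceI: "finite A \<Longrightarrow> (\<And>x. v x \<noteq> 0 \<Longrightarrow> x \<in> A \<and> B x) \<Longrightarrow> v \<in> vspace B"
  unfolding vspace_def vsupp_def by (auto intro: finite_subset[of _ A])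

lemma bvec_vspace [simp]: "B x \<Longrightarrow> (bvec x :: 'a \<Rightarrow> 'k::comm_ring_1) \<in> vspace B"
  by (rule vspaceI[of "{x}"]) (auto simp: bvec_def split: if_splits)

lemma lext_vspace:
  assumes "v \<in> vspace B" "\<And>x. B x \<Longrightarrow> h x \<in> vspace C"
  shows "lext h v \<in> vspace C"
proof -
  have "finite (vsupp (lext h v))"
    using assms by (intro finite_vsupp_lext) (auto simp: vspace_def)
  moreover have "C y" if nz: "lext h v y \<noteq> 0" for y
  proof -
    obtain x where "x \<in> vsupp v" "v x * h x y \<noteq> 0"
      using nz sum.not_neutral_contains_not_neutral[of "\<lambda>x. v x * h x y" "vsupp v"]
      unfolding lext_def by blast
    then show ?thesis using assms
      by (auto intro!: vspace_nonzero[of "h x" C y] dest: vspaceD(2))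
  qed
  ultimately show ?thesis by (auto simp: vspace_def vsupp_def)
qed

text \<open>A list is read as the formal sum of its entries with multiplicity. Coproducts can then
  be given by recursively defined lists, and a linear map applied to them becomes a list
  sum.\<close>

definition lvec :: "'a list \<Rightarrow> 'a \<Rightarrow> 'k::comm_ring_1" where
  "lvec xs = (\<lambda>y. \<Sum>x\<leftarrow>xs. bvec x y)"

lemma lvec_eq_length_filter: "lvec xs y = of_nat (length (filter (\<lambda>x. x = y) xs))"
  by (induction xs) (auto simp: lvec_def bvec_def)

lemma vsupp_lvec: "vsupp (lvec xs) \<subseteq> set xs"
proof
  fix x assume "x \<in> vsupp (lvec xs)"
  then have "length (filter (\<lambda>y. y = x) xs) \<noteq> 0"
    unfolding vsupp_def lvec_eq_length_filter by (auto intro: ccontr)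
  then show "x \<in> set xs"
    by (auto simp: filter_empty_conv)
qed

lemma finite_vsupp_lvec [simp]: "finite (vsupp (lvec xs))"
  by (rule finite_subset[OF vsupp_lvec]) simp

lemma lvec_vspace: "(\<And>x. x \<in> set xs \<Longrightarrow> B x) \<Longrightarrow> lvec xs \<in> vspace B"
  using vsupp_lvec by (fastforce simp: vspace_def)

lemma lvec_Nil [simp]: "lvec [] = (\<lambda>_. 0)"
  by (simp add: lvec_def)

lemma lvec_single [simp]: "lvec [x] = bvec x"
  by (simp add: lvec_def)

lemma lext_lvec:
  fixes g :: "'a \<Rightarrow> 'b \<Rightarrow> 'c::comm_ring_1"
  shows "lext g (lvec xs) y = (\<Sum>x\<leftarrow>xs. g x y)"
proof (induction xs)
  case (Cons x xs)
  have eq: "(lvec (x # xs) :: 'a \<Rightarrow> 'c) = (\<lambda>y. bvec x y + lvec xs y)"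
    by (simp add: lvec_def)
  show ?case unfolding eq using Cons by (subst lext_add) simp_all
qed simp

lemma cat_mul_bvec_right: "cat_mul u (bvec b) = lext (\<lambda>a. bvec (a @ b)) (u :: 'a list \<Rightarrow> 'k::comm_ring_1)"
  by (simp add: cat_mul_def)

lemma cat_mul_bvec_left: "cat_mul (bvec a) u = lext (\<lambda>b. bvec (a @ b)) (u :: 'a list \<Rightarrow> 'k::comm_ring_1)"
  by (simp add: cat_mul_def)

section \<open>Products of lists\<close>

definition lprod :: "('a \<Rightarrow> 'b \<Rightarrow> 'c) \<Rightarrow> 'a list \<Rightarrow> 'b list \<Rightarrow> 'c list" where
  "lprod h xs ys = concat (map (\<lambda>x. map (h x) ys) xs)"

lemma lprod_cong [fundef_cong]:
  "xs = xs' \<Longrightarrow> ys = ys' \<Longrightarrow> (\<And>x y. x \<in> set xs' \<Longrightarrow> y \<in> set ys' \<Longrightarrow> h x y = h' x y) \<Longrightarrow>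
    lprod h xs ys = lprod h' xs' ys'"
  by (auto simp: lprod_def intro!: arg_cong[of _ _ concat])

lemma lprod_simps [simp]:
  "lprod h [] ys = []" "lprod h (x # xs) ys = map (h x) ys @ lprod h xs ys"
  by (simp_all add: lprod_def)

lemma lprod_append: "lprod h (xs @ xs') ys = lprod h xs ys @ lprod h xs' ys"
  by (simp add: lprod_def)

lemma set_lprod [simp]: "set (lprod h xs ys) = {h x y |x y. x \<in> set xs \<and> y \<in> set ys}"
  by (auto simp: lprod_def)

lemma map_lprod: "map f (lprod h xs ys) = lprod (\<lambda>x y. f (h x y)) xs ys"
  by (simp add: lprod_def map_concat o_def)

lemma lprod_map: "lprod h (map f xs) (map g ys) = lprod (\<lambda>x y. h (f x) (g y)) xs ys"
  by (simp add: lprod_def o_def)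

lemma lprod_assoc:
  assumes "\<And>x y z. h (k x y) z = h' x (k' y z)"
  shows "lprod h (lprod k xs ys) zs = lprod h' xs (lprod k' ys zs)"
proof (induction xs)
  case (Cons x xs)
  have "lprod h (map (k x) ys) zs = map (h' x) (lprod k' ys zs)"
    using assms by (induction ys) auto
  then show ?case using Cons by (simp add: lprod_append)
qed simp

lemma sum_lprod: "(\<Sum>x\<leftarrow>lprod h xs ys. g x) = (\<Sum>x\<leftarrow>xs. \<Sum>y\<leftarrow>ys. g (h x y))"
  by (induction xs) (auto simp: o_def)

lemma filter_lprod:
  assumes "\<And>x y. P (h x y) \<longleftrightarrow> Q x \<and> R y"
  shows "filter P (lprod h xs ys) = lprod h (filter Q xs) (filter R ys)"
  by (induction xs) (auto simp: assms filter_map o_def)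

lemma distinct_lprod:
  assumes "distinct xs" "distinct ys"
    and "\<And>x y x' y'. x \<in> set xs \<Longrightarrow> x' \<in> set xs \<Longrightarrow> y \<in> set ys \<Longrightarrow> y' \<in> set ys \<Longrightarrow>
           h x y = h x' y' \<Longrightarrow> x = x' \<and> y = y'"
  shows "distinct (lprod h xs ys)"
  using assms(1,3)
proof (induction xs)
  case (Cons x xs)
  have "distinct (map (h x) ys)"
    using Cons.prems assms(2) by (force simp: distinct_map inj_on_def)
  moreover have "distinct (lprod h xs ys)"
    using Cons.prems by (intro Cons.IH) (simp, meson list.set_intros(2))
  moreover have "set (map (h x) ys) \<inter> set (lprod h xs ys) = {}"
  proof -
    have False if "y \<in> set ys" "x' \<in> set xs" "y' \<in> set ys" "h x y = h x' y'" for y x' y'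
      using Cons.prems(1) Cons.prems(2)[of x x' y y'] that by auto
    then show ?thesis by auto
  qed
  ultimately show ?case by simp
qed simp

lemma sum_list_swap:
  "(\<Sum>x\<leftarrow>xs. \<Sum>y\<leftarrow>ys. f x y) = (\<Sum>y\<leftarrow>ys. \<Sum>x\<leftarrow>xs. f x y :: 'b::comm_monoid_add)"
  by (induction xs) (auto simp: sum_list_addf)

text \<open>The product of the tensor square, transferred to lists of summands.\<close>

definition lcat :: "('a list \<times> 'b list) list \<Rightarrow> ('a list \<times> 'b list) list \<Rightarrow> ('a list \<times> 'b list) list" where
  "lcat = lprod (\<lambda>(a, b) (a', b'). (a @ a', b @ b'))"

lemma tens_mul_lvec: "tens_mul (lvec xs) (lvec ys) = lvec (lcat xs ys)"
  by (rule ext) (simp add: tens_mul_def lext_lvec lcat_def sum_lprod case_prod_unfold lvec_def[of "lprod _ _ _"])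

lemma map_lcat:
  assumes "\<And>a a'. f (a @ a') = f a @ f a'" "\<And>a a'. g (a @ a') = g a @ g a'"
  shows "map (map_prod f g) (lcat xs ys) = lcat (map (map_prod f g) xs) (map (map_prod f g) ys)"
  by (simp add: lcat_def map_lprod lprod_map case_prod_unfold assms)

section \<open>Cuts of terms\<close>

text \<open>A cut of a list of terms keeps the list of upper parts unreduced, so that it can be
  plugged below a node of fixed arity, whereas the list of lower parts is reduced.\<close>

fun cutT :: "'s trm \<Rightarrow> ('s trm \<times> 's trm list) list"
and cutL :: "'s trm list \<Rightarrow> ('s trm list \<times> 's trm list) list" where
  "cutT Bot = [(Bot, [])]"
| "cutT (Node s ts) = (Bot, [Node s ts]) # map (map_prod (Node s) id) (cutL ts)"
| "cutL [] = [([], [])]"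
| "cutL (t # ts) = lprod (\<lambda>(a, b) (as, bs). (a # as, b @ bs)) (cutT t) (cutL ts)"

lemmas trm_induct = cutT_cutL.induct[case_names Bot Node Nil Cons]

lemma sum_cutT_Node:
  "(\<Sum>(a, b)\<leftarrow>cutT (Node s ts). g a b) = g Bot [Node s ts] + (\<Sum>(a, b)\<leftarrow>cutL ts. g (Node s a) b)"
  by (simp add: o_def case_prod_unfold)

lemma sum_cutL_Cons:
  "(\<Sum>(a, b)\<leftarrow>cutL (t # ts). g a b) = (\<Sum>(a, b)\<leftarrow>cutT t. \<Sum>(as, bs)\<leftarrow>cutL ts. g (a # as) (b @ bs))"
  by (simp add: sum_lprod case_prod_unfold)

lemma cutL_append: "cutL (f @ g) = lcat (cutL f) (cutL g)"
proof (induction f)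
  case Nil
  have "map (\<lambda>(a', b'). ([] @ a', [] @ b')) xs = xs" for xs :: "('a trm list \<times> 'a trm list) list"
    by (induction xs) auto
  then show ?case by (simp add: lcat_def)
next
  case (Cons t f)
  then show ?case
    by (simp only: append_Cons cutL.simps lcat_def)
      (rule lprod_assoc[symmetric], auto)
qed

lemma sum_cutL_append:
  "(\<Sum>(a, b)\<leftarrow>cutL (f @ g). h a b) = (\<Sum>(a, b)\<leftarrow>cutL f. \<Sum>(a', b')\<leftarrow>cutL g. h (a @ a') (b @ b'))"
  by (simp add: cutL_append lcat_def sum_lprod case_prod_unfold)

lemma rd_simps [simp]:
  "rd [] = []" "rd (Bot # f) = rd f" "rd (Node s ts # f) = Node s ts # rd f" "rd (f @ g) = rd f @ rd g"
  by (simp_all add: rd_def)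

lemma rd_eq_self_iff: "rd f = f \<longleftrightarrow> Bot \<notin> set f"
  by (auto simp: rd_def filter_id_conv)

lemma sum_list_cong_prod:
  "(\<And>a b. (a, b) \<in> set xs \<Longrightarrow> f a b = g a b) \<Longrightarrow> (\<Sum>(a, b)\<leftarrow>xs. f a b) = (\<Sum>(a, b)\<leftarrow>xs. g a b)"
  by (intro arg_cong[of _ _ sum_list] map_cong) auto

lemma sum_list_swap_prod:
  "(\<Sum>(a, b)\<leftarrow>xs. \<Sum>(c, d)\<leftarrow>ys. f a b c d) = (\<Sum>(c, d)\<leftarrow>ys. \<Sum>(a, b)\<leftarrow>xs. f a b c d :: 'b::comm_monoid_add)"
  unfolding case_prod_unfold by (rule sum_list_swap)

text \<open>Both sides run over the divisions of a term into three layers. Only \<open>b1\<close>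
  has to be reduced: it is an upper part and may contain leaves, whereas \<open>a2\<close>, a lower
  part, is already reduced. Arbitrary summands \<open>gT\<close> and \<open>gL\<close> in a
  commutative monoid spare any bijection between the two index lists.\<close>

lemma cut_coassoc:
  fixes gT :: "'s trm \<Rightarrow> 's trm list \<Rightarrow> 's trm list \<Rightarrow> 'b::comm_monoid_add"
    and gL :: "'s trm list \<Rightarrow> 's trm list \<Rightarrow> 's trm list \<Rightarrow> 'b"
  shows "(\<Sum>(a, b)\<leftarrow>cutT t. \<Sum>(a1, a2)\<leftarrow>cutT a. gT a1 a2 b)
       = (\<Sum>(a, b)\<leftarrow>cutT t. \<Sum>(b1, b2)\<leftarrow>cutL b. gT a (rd b1) b2)"
    and "(\<Sum>(a, b)\<leftarrow>cutL ts. \<Sum>(a1, a2)\<leftarrow>cutL a. gL a1 a2 b)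
       = (\<Sum>(a, b)\<leftarrow>cutL ts. \<Sum>(b1, b2)\<leftarrow>cutL b. gL a (rd b1) b2)"
proof (induction t and ts arbitrary: gT and gL rule: trm_induct)
  case (Node s ts)
  have "(\<Sum>(a, b)\<leftarrow>cutT (Node s ts). \<Sum>(a1, a2)\<leftarrow>cutT a. gT a1 a2 b)
      = gT Bot [] [Node s ts] + (\<Sum>(a, b)\<leftarrow>cutL ts. gT Bot [Node s a] b)
        + (\<Sum>(a, b)\<leftarrow>cutL ts. \<Sum>(a1, a2)\<leftarrow>cutL a. gT (Node s a1) a2 b)"
    by (simp add: sum_cutT_Node case_prod_unfold o_def sum_list_addf add.assoc)
  also have "(\<Sum>(a, b)\<leftarrow>cutL ts. \<Sum>(a1, a2)\<leftarrow>cutL a. gT (Node s a1) a2 b)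
      = (\<Sum>(a, b)\<leftarrow>cutL ts. \<Sum>(b1, b2)\<leftarrow>cutL b. gT (Node s a) (rd b1) b2)"
    by (rule Node)
  \<comment> \<open>The summands with empty top layer: below an empty top, what is left to cut is
    the one-tree list \<open>[Node s ts]\<close>.\<close>
  also have "gT Bot [] [Node s ts] + (\<Sum>(a, b)\<leftarrow>cutL ts. gT Bot [Node s a] b)
      = (\<Sum>(b1, b2)\<leftarrow>cutL [Node s ts]. gT Bot (rd b1) b2)"
    by (simp only: sum_cutL_Cons sum_cutT_Node) simp
  finally show ?case
    by (simp only: sum_cutT_Node)
next
  case (Cons t ts)
  have "(\<Sum>(a, b)\<leftarrow>cutL (t # ts). \<Sum>(a1, a2)\<leftarrow>cutL a. gL a1 a2 b)
     = (\<Sum>(a, b)\<leftarrow>cutT t. \<Sum>(a1, a2)\<leftarrow>cutT a. \<Sum>(as, bs)\<leftarrow>cutL ts. \<Sum>(as1, as2)\<leftarrow>cutL as.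
          gL (a1 # as1) (a2 @ as2) (b @ bs))"
    by (simp only: sum_cutL_Cons) (rule sum_list_cong_prod, rule sum_list_swap_prod)
  also have "\<dots> = (\<Sum>(a, b)\<leftarrow>cutT t. \<Sum>(a1, a2)\<leftarrow>cutT a. \<Sum>(as, bs)\<leftarrow>cutL ts. \<Sum>(bs1, bs2)\<leftarrow>cutL bs.
          gL (a1 # as) (a2 @ rd bs1) (b @ bs2))"
    by (rule sum_list_cong_prod, rule sum_list_cong_prod, rule Cons.IH(2))
  \<comment> \<open>The whole inner double sum over \<open>ts\<close> plays the role of
    \<open>gT\<close>; this is why the induction must leave that function arbitrary.\<close>
  also have "\<dots> = (\<Sum>(a, b)\<leftarrow>cutT t. \<Sum>(b1, b2)\<leftarrow>cutL b. \<Sum>(as, bs)\<leftarrow>cutL ts. \<Sum>(bs1, bs2)\<leftarrow>cutL bs.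
          gL (a # as) (rd b1 @ rd bs1) (b2 @ bs2))"
    by (rule Cons.IH(1))
  also have "\<dots> = (\<Sum>(a, b)\<leftarrow>cutL (t # ts). \<Sum>(b1, b2)\<leftarrow>cutL b. gL a (rd b1) b2)"
    by (simp only: sum_cutL_Cons sum_cutL_append rd_simps(4)) (rule sum_list_cong_prod, rule sum_list_swap_prod)
  finally show ?case .
qed simp_all

section \<open>Degrees, trimming and extreme cuts\<close>

lemma degF_simps [simp]:
  "degF [] = 0" "degF (t # f) = deg t + degF f" "degF (f @ g) = degF f + degF g"
  by (simp_all add: degF_def)

lemma deg_Node: "deg (Node s ts) = Suc (degF ts)"
  by (simp add: degF_def)

declare deg.simps(2) [simp del] deg_Node [simp]

lemma deg_eq_0_iff [simp]: "deg t = 0 \<longleftrightarrow> t = Bot"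
  by (cases t) auto

lemma degF_eq_0: "degF f = 0 \<Longrightarrow> Bot \<notin> set f \<Longrightarrow> f = []"
  by (cases f) auto

lemma trF_simps [simp]:
  "trF [] = []" "trF (t # f) = trT t @ trF f" "trF (f @ g) = trF f @ trF g"
  by (simp_all add: trF_def)

lemma trT_Node: "trT (Node s ts) = [Node s (trF ts)]"
  by (simp add: trF_def)

declare trT.simps(2) [simp del] trT_Node [simp]

lemma trF_rd [simp]: "trF (rd f) = trF f"
proof (induction f)
  case (Cons t f)
  then show ?case by (cases t) auto
qed simp

lemma trF_eq_Nil_iff: "trF f = [] \<longleftrightarrow> rd f = []"
proof (induction f)
  case (Cons t f)
  then show ?case by (cases t) auto
qed simp

lemma degF_rd [simp]: "degF (rd f) = degF f"
proof (induction f)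
  case (Cons t f)
  then show ?case by (cases t) auto
qed simp

lemma degF_tr [simp]:
  fixes t :: "'s trm" and f :: "'s trm list"
  shows "degF (trT t) = deg t" "degF (trF f) = degF f"
  by (induction t and f rule: trm_induct) auto

lemma tr_idem [simp]:
  fixes t :: "'s trm" and f :: "'s trm list"
  shows "trF (trT t) = trT t" "trF (trF f) = trF f"
  by (induction t and f rule: trm_induct) auto

lemma cut_deg:
  fixes t :: "'s trm" and ts :: "'s trm list"
  shows "(a, b) \<in> set (cutT t) \<Longrightarrow> deg a + degF b = deg t"
    and "(as, bs) \<in> set (cutL ts) \<Longrightarrow> degF as + degF bs = degF ts"
proof (induction t and ts arbitrary: a b and as bs rule: trm_induct)
  case (Cons t ts)
  from Cons.prems show ?case by (auto simp: Cons.IH[symmetric])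
qed auto

lemma length_cutL: "(as, bs) \<in> set (cutL ts) \<Longrightarrow> length as = length ts"
  by (induction ts arbitrary: as bs) auto

lemma cut_no_Bot:
  fixes t :: "'s trm" and ts :: "'s trm list"
  shows "(a, b) \<in> set (cutT t) \<Longrightarrow> Bot \<notin> set b"
    and "(as, bs) \<in> set (cutL ts) \<Longrightarrow> Bot \<notin> set bs"
proof (induction t and ts arbitrary: a b and as bs rule: trm_induct)
  case (Cons t ts)
  then show ?case by (auto 0 3)
qed auto

lemma cut_wf:
  fixes t :: "'s trm" and ts :: "'s trm list"
  shows "(a, b) \<in> set (cutT t) \<Longrightarrow> wf_trm S ar t \<Longrightarrow> wf_trm S ar a \<and> (\<forall>u\<in>set b. wf_trm S ar u)"
    and "(as, bs) \<in> set (cutL ts) \<Longrightarrow> \<forall>u\<in>set ts. wf_trm S ar u \<Longrightarrow>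
           \<forall>u\<in>set as \<union> set bs. wf_trm S ar u"
proof (induction t and ts arbitrary: a b and as bs rule: trm_induct)
  case (Node s ts)
  then show ?case using length_cutL[of _ _ ts] by (auto 0 3)
next
  case (Cons t ts)
  then show ?case by (auto 0 3)
qed auto

text \<open>One half of the counit axiom in list form; multiplicity one is part of the claim. A
  concatenation of lower parts is empty only if both are, which lets the filter pass to the two
  factors of \<open>lprod\<close>.\<close>

lemma cut_snd_Nil:
  fixes t :: "'s trm" and ts :: "'s trm list"
  shows "filter (\<lambda>(a, b). b = []) (cutT t) = [(t, [])]"
    and "filter (\<lambda>(a, b). b = []) (cutL ts) = [(ts, [])]"
proof (induction t and ts rule: trm_induct)
  case (Node s ts)
  then show ?case by (simp add: filter_map o_def case_prod_unfold)
next
  case (Cons t ts)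
  have "filter (\<lambda>(a, b). b = []) (cutL (t # ts)) = lprod (\<lambda>(a, b) (as, bs). (a # as, b @ bs))
      (filter (\<lambda>(a, b). b = []) (cutT t)) (filter (\<lambda>(a, b). b = []) (cutL ts))"
    unfolding cutL.simps by (rule filter_lprod) auto
  with Cons show ?case by simp
qed auto

lemma rd_Cons_eq_Nil: "rd (t # f) = [] \<longleftrightarrow> t = Bot \<and> rd f = []"
  by (cases t) auto

text \<open>The lower part is \<open>rd ts\<close> because a leaf is never cut off: its only cut
  keeps it in the upper part.\<close>

lemma cut_fst_Nil:
  fixes t :: "'s trm" and ts :: "'s trm list"
  shows "filter (\<lambda>(a, b). a = Bot) (cutT t) = [(Bot, rd [t])]"
    and "filter (\<lambda>(a, b). rd a = []) (cutL ts) = [(map (\<lambda>_. Bot) ts, rd ts)]"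
proof (induction t and ts rule: trm_induct)
  case (Node s ts)
  then show ?case by (simp add: filter_map o_def case_prod_unfold)
next
  case (Cons t ts)
  have "filter (\<lambda>(a, b). rd a = []) (cutL (t # ts)) = lprod (\<lambda>(a, b) (as, bs). (a # as, b @ bs))
      (filter (\<lambda>(a, b). a = Bot) (cutT t)) (filter (\<lambda>(a, b). rd a = []) (cutL ts))"
    unfolding cutL.simps by (rule filter_lprod) (auto simp: rd_Cons_eq_Nil)
  with Cons show ?case by (cases t) simp_all
qed auto

section \<open>Cut lists of the two bialgebras\<close>

definition cutN :: "'s trm list \<Rightarrow> ('s trm list \<times> 's trm list) list" where
  "cutN f = map (map_prod rd id) (cutL f)"

text \<open>Trimming both components makes the list meaningful for untrimmed forests and dependent
  on \<open>trF f\<close> alone; if \<open>f\<close> is trimmed already, so are the lower parts, and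
  the second trimming changes nothing.\<close>

definition cutK :: "'s trm list \<Rightarrow> ('s trm list \<times> 's trm list) list" where
  "cutK f = map (map_prod trF trF) (cutL f)"

lemma sum_cutN: "(\<Sum>(a, b)\<leftarrow>cutN f. g a b) = (\<Sum>(a, b)\<leftarrow>cutL f. g (rd a) b)"
  by (simp add: cutN_def o_def case_prod_unfold)

lemma sum_cutK: "(\<Sum>(a, b)\<leftarrow>cutK f. g a b) = (\<Sum>(a, b)\<leftarrow>cutL f. g (trF a) (trF b))"
  by (simp add: cutK_def o_def case_prod_unfold)

lemma cutN_append: "cutN (f @ g) = lcat (cutN f) (cutN g)"
  by (simp add: cutN_def cutL_append map_lcat)

lemma cutK_append: "cutK (f @ g) = lcat (cutK f) (cutK g)"
  by (simp add: cutK_def cutL_append map_lcat)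

lemma cutN_Cons: "cutN (t # f) = lcat (map (\<lambda>(a, b). (rd [a], b)) (cutT t)) (cutN f)"
proof -
  have "cutN [t] = map (\<lambda>(a, b). (rd [a], b)) (cutT t)"
    by (simp add: cutN_def map_lprod lprod_def case_prod_unfold o_def)
  then show ?thesis using cutN_append[of "[t]" f] by simp
qed

lemma cutK_Cons: "cutK (t # f) = lcat (map (map_prod trT trF) (cutT t)) (cutK f)"
proof -
  have "cutK [t] = map (map_prod trT trF) (cutT t)"
    by (auto simp: cutK_def map_lprod lprod_def case_prod_unfold o_def map_prod_def)
  then show ?thesis using cutK_append[of "[t]" f] by simp
qed

lemma lcat_unit [simp]: "lcat [([], [])] xs = xs" "lcat xs [([], [])] = xs"
  by (simp_all add: lcat_def lprod_def case_prod_unfold o_def)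

lemma cutN_Nil [simp]: "cutN [] = [([], [])]" and cutK_Nil [simp]: "cutK [] = [([], [])]"
  by (simp_all add: cutN_def cutK_def)

lemma cutN_rd: "cutN (rd f) = cutN f"
proof (induction f)
  case (Cons t f)
  then show ?case by (cases t) (auto simp: cutN_Cons)
qed simp

text \<open>A leaf has a single cut and disappears from it under trimming, so a forest and its
  trimming have the same cut list, in the same order. Together with \<open>cutK_eq_map_cutN\<close>
  this is the compatibility of trimming with the coproducts.\<close>

lemma cutK_trF:
  fixes t :: "'s trm" and f :: "'s trm list"
  shows "cutK (trT t) = map (map_prod trT trF) (cutT t)"
    and "cutK (trF f) = cutK f"
proof (induction t and f rule: trm_induct)
  case (Node s ts)
  have "map (\<lambda>(a, b). ([Node s a], b)) (cutK (trF ts)) = map (\<lambda>(a, b). ([Node s a], b)) (cutK ts)"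
    using Node by simp
  then show ?case
    by (simp add: cutK_Cons) (simp add: cutK_def o_def case_prod_unfold map_prod_def)
next
  case (Cons t f)
  then show ?case by (simp add: cutK_append cutK_Cons)
qed (auto simp: cutK_def)

lemma cutK_eq_map_cutN: "map (map_prod trF trF) (cutN f) = cutK f"
  by (simp add: cutN_def cutK_def o_def map_prod_def case_prod_unfold)

lemma cutN_coassoc:
  fixes g :: "'s trm list \<Rightarrow> 's trm list \<Rightarrow> 's trm list \<Rightarrow> 'b::comm_monoid_add"
  shows "(\<Sum>(a, b)\<leftarrow>cutN f. \<Sum>(a1, a2)\<leftarrow>cutN a. g a1 a2 b) = (\<Sum>(a, b)\<leftarrow>cutN f. \<Sum>(b1, b2)\<leftarrow>cutN b. g a b1 b2)"
  unfolding sum_cutN[of _ f] cutN_rd unfolding sum_cutN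
  by (rule cut_coassoc(2)[of "\<lambda>a1 a2 b. g (rd a1) a2 b" f])

lemma cutK_coassoc:
  fixes g :: "'s trm list \<Rightarrow> 's trm list \<Rightarrow> 's trm list \<Rightarrow> 'b::comm_monoid_add"
  shows "(\<Sum>(a, b)\<leftarrow>cutK f. \<Sum>(a1, a2)\<leftarrow>cutK a. g a1 a2 b) = (\<Sum>(a, b)\<leftarrow>cutK f. \<Sum>(b1, b2)\<leftarrow>cutK b. g a b1 b2)"
  unfolding sum_cutK[of _ f] cutK_trF unfolding sum_cutK
  using cut_coassoc(2)[of "\<lambda>a1 a2 b. g (trF a1) (trF a2) (trF b)" f] by simp

lemma filter_cutN_Nil:
  assumes "Bot \<notin> set f"
  shows "filter (\<lambda>(a, b). a = []) (cutN f) = [([], f)]" "filter (\<lambda>(a, b). b = []) (cutN f) = [(f, [])]"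
proof -
  have "rd f = f" using assms by (simp add: rd_eq_self_iff)
  moreover have "rd (map (\<lambda>_. Bot) f) = []" by (induction f) auto
  ultimately show "filter (\<lambda>(a, b). a = []) (cutN f) = [([], f)]" "filter (\<lambda>(a, b). b = []) (cutN f) = [(f, [])]"
    using cut_fst_Nil(2)[of f] cut_snd_Nil(2)[of f]
    by (simp_all add: cutN_def filter_map o_def case_prod_unfold)
qed

lemma cutN_props:
  assumes "(a, b) \<in> set (cutN f)"
  shows "degF a + degF b = degF f" and "N_basis S ar f \<Longrightarrow> N_basis S ar a \<and> N_basis S ar b"
proof -
  obtain a' where a': "(a', b) \<in> set (cutL f)" "a = rd a'"
    using assms by (auto simp: cutN_def)
  show "degF a + degF b = degF f" using cut_deg(2)[OF a'(1)] a'(2) by simp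
  show "N_basis S ar a \<and> N_basis S ar b" if "N_basis S ar f"
    using cut_wf(2)[OF a'(1), of S ar] cut_no_Bot(2)[OF a'(1)] that a'(2) by (auto simp: N_basis_def rd_def)
qed

section \<open>Grafting decompositions as cuts\<close>

fun decT :: "'s trm \<Rightarrow> ('s trm \<times> 's trm list) list"
and decL :: "'s trm list \<Rightarrow> ('s trm list \<times> 's trm list) list" where
  "decT Bot = [(Bot, [Bot])]"
| "decT (Node s ts) = (Bot, [Node s ts]) # map (map_prod (Node s) id) (decL ts)"
| "decL [] = [([], [])]"
| "decL (t # ts) = lprod (\<lambda>(a, b) (as, bs). (a # as, b @ bs)) (decT t) (decL ts)"

text \<open>Grafting consumes one lower term for each leaf of the upper term, so \<open>decT\<close>
  keeps the leaves among the lower terms; forgetting them gives the cuts.\<close>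

lemma cut_eq_map_dec:
  fixes t :: "'s trm" and ts :: "'s trm list"
  shows "cutT t = map (map_prod id rd) (decT t)"
    and "cutL ts = map (map_prod id rd) (decL ts)"
proof (induction t and ts rule: trm_induct)
  case (Cons t ts)
  then show ?case by (simp add: map_lprod lprod_map case_prod_unfold)
qed (auto simp: o_def case_prod_unfold)

text \<open>The upper term alone determines the decomposition. This is stronger than distinctness of
  the pairs, and it survives \<open>lprod\<close> because list construction is injective, while
  concatenated lower lists could be split in several ways.\<close>

lemma distinct_dec:
  fixes t :: "'s trm" and ts :: "'s trm list"
  shows "distinct (map fst (decT t))"
    and "distinct (map fst (decL ts))"
proof (induction t and ts rule: trm_induct)
  case (Node s ts)
  have "map fst (map (map_prod (Node s) id) (decL ts)) = map (Node s) (map fst (decL ts))" by simp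
  then show ?case using Node by (auto simp: distinct_map[of "Node s"] inj_on_def simp del: map_map)
next
  case (Cons t ts)
  have "map fst (decL (t # ts)) = lprod (#) (map fst (decT t)) (map fst (decL ts))"
    by (simp add: map_lprod lprod_map case_prod_unfold)
  then show ?case using Cons by (auto intro!: distinct_lprod)
qed auto

text \<open>\<open>graftL\<close> consumes a prefix of its input and hands on the rest, so the
  induction has to allow a surplus \<open>xs\<close> behind the terms that are used.\<close>

lemma dec_sound:
  shows "(a, us) \<in> set (decT t) \<Longrightarrow> wf_trm S ar t \<Longrightarrow>
      wf_trm S ar a \<and> length us = nleaves a \<and> (\<forall>u\<in>set us. wf_trm S ar u) \<and> graftL a (us @ xs) = (t, xs)"
    and "(as, us) \<in> set (decL ts) \<Longrightarrow> \<forall>t\<in>set ts. wf_trm S ar t \<Longrightarrow>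
      length as = length ts \<and> (\<forall>a\<in>set as. wf_trm S ar a) \<and> length us = sum_list (map nleaves as) \<and>
      (\<forall>u\<in>set us. wf_trm S ar u) \<and> graftsL as (us @ xs) = (ts, xs)"
proof (induction t and ts arbitrary: a us xs and as us xs rule: trm_induct)
  case (Node s ts)
  show ?case
  proof (cases "(a, us) = (Bot, [Node s ts])")
    case True
    with Node.prems show ?thesis by simp
  next
    case False
    then obtain as where "a = Node s as" "(as, us) \<in> set (decL ts)"
      using Node.prems(1) by auto
    then show ?thesis using Node.IH[of as us xs] Node.prems(2) by auto
  qed
next
  case (Cons t ts)
  obtain a us1 as' us2 where *: "as = a # as'" "us = us1 @ us2" "(a, us1) \<in> set (decT t)" "(as', us2) \<in> set (decL ts)"
    using Cons.prems(1) by auto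
  have "wf_trm S ar t" "\<forall>t\<in>set ts. wf_trm S ar t"
    using Cons.prems(2) by simp_all
  note 1 = Cons.IH(1)[OF *(3) this(1), of "us2 @ xs"] and 2 = Cons.IH(2)[OF *(4) this(2), of xs]
  show ?case using 1 2 *(1,2) by auto
qed auto

text \<open>The length bound excludes the default \<open>graftL Bot [] = (Bot, [])\<close>, where a
  leaf would count as grafted although no lower term was supplied.\<close>

lemma dec_complete:
  shows "graftL a us = (t, rest) \<Longrightarrow> nleaves a \<le> length us \<Longrightarrow>
      \<exists>vs. us = vs @ rest \<and> length vs = nleaves a \<and> (a, vs) \<in> set (decT t)"
    and "graftsL as us = (ts, rest) \<Longrightarrow> sum_list (map nleaves as) \<le> length us \<Longrightarrow>
      \<exists>vs. us = vs @ rest \<and> length vs = sum_list (map nleaves as) \<and> (as, vs) \<in> set (decL ts)"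
proof (induction a and as arbitrary: us t rest and us ts rest rule: trm_induct)
  case Bot
  then obtain u us' where "us = u # us'" by (cases us) auto
  then show ?case using Bot by (cases t) auto
next
  case (Node s as)
  obtain ts where ts: "graftsL as us = (ts, rest)" "t = Node s ts"
    using Node.prems(1) by (auto split: prod.splits)
  then show ?case using Node.IH[OF ts(1)] Node.prems(2) by force
next
  case (Cons a as)
  obtain t ys ts' where *: "graftL a us = (t, ys)" "graftsL as ys = (ts', rest)" "ts = t # ts'"
    using Cons.prems(1) by (auto split: prod.splits)
  obtain vs where vs: "us = vs @ ys" "length vs = nleaves a" "(a, vs) \<in> set (decT t)"
    using Cons.IH(1)[OF *(1)] Cons.prems(2) by auto
  obtain vs' where vs': "ys = vs' @ rest" "length vs' = sum_list (map nleaves as)" "(as, vs') \<in> set (decL ts')"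
    using Cons.IH(2)[OF *(2)] Cons.prems(2) vs by auto
  show ?case using vs vs' * by (intro exI[of _ "vs @ vs'"]) fastforce
qed auto

lemma decomps_eq: "wf_trm S ar t \<Longrightarrow> decomps S ar t = set (decT t)"
proof -
  assume wf: "wf_trm S ar t"
  have "(a, us) \<in> set (decT t)" if len: "length us = nleaves a" and gr: "graft a us = t" for a us
  proof -
    obtain rest where r: "graftL a us = (t, rest)"
      using gr unfolding graft_def by (metis prod.collapse)
    with dec_complete(1)[OF r] len show ?thesis by auto
  qed
  moreover have "wf_trm S ar a \<and> length us = nleaves a \<and> (\<forall>u\<in>set us. wf_trm S ar u) \<and> graft a us = t"
    if "(a, us) \<in> set (decT t)" for a us
    using dec_sound(1)[OF that wf, of "[]"] by (auto simp: graft_def)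
  ultimately have "(a, us) \<in> decomps S ar t \<longleftrightarrow> (a, us) \<in> set (decT t)" for a us
    unfolding decomps_def by blast
  then show ?thesis by auto
qed

text \<open>The bridge between coefficients defined as cardinalities and lists of summands;
  \<open>h\<close> may identify entries, which is where multiplicities arise.\<close>

lemma lvec_map_eq_card:
  assumes "distinct xs"
  shows "lvec (map h xs) y = of_nat (card {x \<in> set xs. h x = y})"
proof -
  have "{x \<in> set xs. h x = y} = set (filter (\<lambda>x. h x = y) xs)" by auto
  then show ?thesis
    using assms by (simp add: lvec_eq_length_filter filter_map o_def distinct_card del: set_filter)
qed

lemma copT_eq:
  assumes "wf_trm S ar t"
  shows "(copT S ar t :: _ \<Rightarrow> 'k::comm_ring_1) = lvec (map (\<lambda>(a, b). (rd [a], b)) (cutT t))"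
proof
  fix xy :: "'a trm list \<times> 'a trm list"
  obtain x y where xy: "xy = (x, y)" by force
  have "distinct (decT t)"
    using distinct_dec(1)[of t] by (simp add: distinct_map)
  then have "(lvec (map (\<lambda>(a, us). (rd [a], rd us)) (decT t)) (x, y) :: 'k)
      = of_nat (card {p \<in> set (decT t). (\<lambda>(a, us). (rd [a], rd us)) p = (x, y)})"
    by (rule lvec_map_eq_card)
  also have "{p \<in> set (decT t). (\<lambda>(a, us). (rd [a], rd us)) p = (x, y)}
      = {(t', ts). (t', ts) \<in> decomps S ar t \<and> rd [t'] = x \<and> rd ts = y}"
    by (auto simp: decomps_eq[OF assms])
  finally show "(copT S ar t xy :: 'k) = lvec (map (\<lambda>(a, b). (rd [a], b)) (cutT t)) xy"
    by (simp add: cut_eq_map_dec copT_def xy o_def case_prod_unfold)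
qed

lemma copN_eq: "N_basis S ar f \<Longrightarrow> copN S ar f = lvec (cutN f)"
  by (induction f) (auto simp: N_basis_def copT_eq cutN_Cons tens_mul_lvec)

section \<open>Admissible cuts of trimmed forests\<close>

lemma K_basis_simps [simp]:
  "K_basis S ar []" "K_basis S ar (t # f) \<longleftrightarrow> trim_wf S ar t \<and> K_basis S ar f"
  "K_basis S ar (f @ g) \<longleftrightarrow> K_basis S ar f \<and> K_basis S ar g"
  by (auto simp: K_basis_def)

lemma K_basis_no_Bot: "K_basis S ar f \<Longrightarrow> Bot \<notin> set f"
  by (auto simp: K_basis_def)

lemma trim_wf_Node: "trim_wf S ar (Node s ts) \<longleftrightarrow> s \<in> S \<and> length ts \<le> ar s \<and> K_basis S ar ts"
  by (auto simp: K_basis_def)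

declare trim_wf.simps(2) [simp del] trim_wf_Node [simp]

lemma tr_trimmed:
  fixes t :: "'s trm" and f :: "'s trm list"
  shows "trim_wf S ar t \<Longrightarrow> trT t = [t]" "K_basis S ar f \<Longrightarrow> trF f = f"
  by (induction t and f rule: trm_induct) auto

lemma length_trF: "length (trF f) \<le> length f"
proof (induction f)
  case (Cons t f)
  then show ?case by (cases t) auto
qed simp

lemma K_basis_tr:
  fixes t :: "'s trm" and f :: "'s trm list"
  shows "wf_trm S ar t \<Longrightarrow> K_basis S ar (trT t)"
    and "\<forall>t\<in>set f. wf_trm S ar t \<Longrightarrow> K_basis S ar (trF f)"
proof (induction t and f rule: trm_induct)
  case (Node s ts)
  then show ?case using length_trF[of ts] by auto
qed auto

text \<open>The upper part of a cut carries \<open>Bot\<close> in place of each child cut off, so it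
  is trimmed only after \<open>trT\<close>. Losing children is harmless, as a node \<open>s\<close>
  of a trimmed tree may have any number of children up to \<open>ar s\<close>.\<close>

lemma cut_trimmed:
  fixes t :: "'s trm" and ts :: "'s trm list"
  shows "(a, b) \<in> set (cutT t) \<Longrightarrow> trim_wf S ar t \<Longrightarrow> K_basis S ar (trT a) \<and> K_basis S ar b"
    and "(as, bs) \<in> set (cutL ts) \<Longrightarrow> K_basis S ar ts \<Longrightarrow> K_basis S ar (trF as) \<and> K_basis S ar bs"
proof (induction t and ts arbitrary: a b and as bs rule: trm_induct)
  case (Node s ts)
  show ?case
  proof (cases "(a, b) = (Bot, [Node s ts])")
    case True
    with Node.prems show ?thesis by simp
  next
    case False
    then obtain as where as: "a = Node s as" "(as, b) \<in> set (cutL ts)"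
      using Node.prems(1) by auto
    then show ?thesis
      using Node.IH[OF as(2)] Node.prems(2) length_cutL[OF as(2)] length_trF[of as] by auto
  qed
next
  case (Cons t ts)
  obtain a b as' bs' where *: "as = a # as'" "bs = b @ bs'" "(a, b) \<in> set (cutT t)" "(as', bs') \<in> set (cutL ts)"
    using Cons.prems(1) by auto
  have "trim_wf S ar t" "K_basis S ar ts" using Cons.prems(2) by simp_all
  note 1 = Cons.IH(1)[OF *(3) this(1)] and 2 = Cons.IH(2)[OF *(4) this(2)]
  show ?case using 1 2 *(1,2) by auto
qed auto

lemma cutK_props:
  assumes "(a, b) \<in> set (cutK f)"
  shows "degF a + degF b = degF f" and "K_basis S ar f \<Longrightarrow> K_basis S ar a \<and> K_basis S ar b"
proof -
  obtain a' b' where *: "(a', b') \<in> set (cutL f)" "a = trF a'" "b = trF b'"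
    using assms by (auto simp: cutK_def)
  show "degF a + degF b = degF f" using cut_deg(2)[OF *(1)] * by simp
  show "K_basis S ar a \<and> K_basis S ar b" if "K_basis S ar f"
    using cut_trimmed(2)[OF *(1) that] *(2,3) tr_trimmed(2)[of S ar b'] by simp
qed

lemma filter_cutK_Nil:
  assumes "K_basis S ar f"
  shows "filter (\<lambda>(a, b). a = []) (cutK f) = [([], f)]" "filter (\<lambda>(a, b). b = []) (cutK f) = [(f, [])]"
proof -
  have f: "rd f = f" "trF f = f"
    using assms by (auto simp: rd_eq_self_iff K_basis_no_Bot tr_trimmed)
  have "trF b = [] \<longleftrightarrow> b = []" if "(a, b) \<in> set (cutL f)" for a b
    using cut_no_Bot(2)[OF that] by (simp add: trF_eq_Nil_iff) (metis rd_eq_self_iff rd_simps(1))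
  then have "filter (\<lambda>(a, b). trF b = []) (cutL f) = filter (\<lambda>(a, b). b = []) (cutL f)"
    by (intro filter_cong) auto
  with f show "filter (\<lambda>(a, b). b = []) (cutK f) = [(f, [])]"
    using cut_snd_Nil(2)[of f] by (simp add: cutK_def filter_map o_def case_prod_unfold)
  have "trF (map (\<lambda>_. Bot) f) = []" by (induction f) auto
  with f show "filter (\<lambda>(a, b). a = []) (cutK f) = [([], f)]"
    using cut_fst_Nil(2)[of f] by (simp add: cutK_def filter_map o_def case_prod_unfold trF_eq_Nil_iff)
qed

text \<open>Ancestor-closed node sets, enumerated in the order of the cuts so that the two lists match
  entrywise.\<close>

fun idT :: "nat \<Rightarrow> 's trm \<Rightarrow> nat set list"
and idL :: "nat \<Rightarrow> 's trm list \<Rightarrow> nat set list" where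
  "idT k Bot = [{}]"
| "idT k (Node s ts) = {} # map (insert k) (idL (Suc k) ts)"
| "idL k [] = [{}]"
| "idL k (t # ts) = lprod (\<union>) (idT k t) (idL (k + deg t) ts)"

lemma id_subset:
  fixes t :: "'s trm" and ts :: "'s trm list"
  shows "I \<in> set (idT k t) \<Longrightarrow> I \<subseteq> {k..<k + deg t}"
    and "I \<in> set (idL k ts) \<Longrightarrow> I \<subseteq> {k..<k + degF ts}"
proof (induction k t and k ts arbitrary: I and I rule: idT_idL.induct)
  case (2 k s ts)
  then show ?case by (auto, fastforce+)
next
  case (4 k t ts)
  then show ?case by (auto, fastforce+)
qed auto

text \<open>The preorder numbers of a tree and of the trees after it fill disjoint intervals, so a
  union of chosen sets can be split again; likewise an inserted root number can be removed
  again.\<close>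

lemma distinct_id:
  fixes t :: "'s trm" and ts :: "'s trm list"
  shows "distinct (idT k t)" and "distinct (idL k ts)"
proof (induction k t and k ts rule: idT_idL.induct)
  case (2 k s ts)
  have "inj_on (insert k) (set (idL (Suc k) ts))"
  proof (rule inj_onI)
    fix I J assume "I \<in> set (idL (Suc k) ts)" "J \<in> set (idL (Suc k) ts)" "insert k I = insert k J"
    moreover from this have "k \<notin> I" "k \<notin> J"
      using id_subset(2)[of _ "Suc k" ts] by fastforce+
    ultimately show "I = J" by (metis insert_ident)
  qed
  then show ?case using 2 by (auto simp: distinct_map)
next
  case (4 k t ts)
  show ?case unfolding idL.simps
  proof (rule distinct_lprod[OF 4])
    fix I J I' J'
    assume h: "I \<in> set (idT k t)" "I' \<in> set (idT k t)" "J \<in> set (idL (k + deg t) ts)"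
      "J' \<in> set (idL (k + deg t) ts)" and eq: "I \<union> J = I' \<union> J'"
    let ?A = "{k..<k + deg t}" and ?B = "{k + deg t..<k + deg t + degF ts}"
    have "?A \<inter> ?B = {}" by auto
    with id_subset(1)[OF h(1)] id_subset(1)[OF h(2)] id_subset(2)[OF h(3)] id_subset(2)[OF h(4)]
    have "I = (I \<union> J) \<inter> ?A" "I' = (I' \<union> J') \<inter> ?A" "J = (I \<union> J) \<inter> ?B" "J' = (I' \<union> J') \<inter> ?B"
      by blast+
    then show "I = I' \<and> J = J'" using eq by metis
  qed
qed auto

definition up_closed :: "(nat \<times> nat) set \<Rightarrow> nat set \<Rightarrow> bool" where
  "up_closed E I \<longleftrightarrow> (\<forall>(i, j)\<in>E. j \<in> I \<longrightarrow> i \<in> I)"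

lemma up_closed_simps [simp]:
  "up_closed {} I" "up_closed (E \<union> E') I \<longleftrightarrow> up_closed E I \<and> up_closed E' I"
  "up_closed (insert (i, j) E) I \<longleftrightarrow> (j \<in> I \<longrightarrow> i \<in> I) \<and> up_closed E I"
  by (auto simp: up_closed_def)

lemma edges_range:
  fixes t :: "'s trm" and ts :: "'s trm list"
  shows "edgesT k t \<subseteq> {k..<k + deg t} \<times> {k..<k + deg t}"
    and "edgesL p k ts \<subseteq> ({p} \<union> {k..<k + degF ts}) \<times> {k..<k + degF ts}"
proof (induction k t and p k ts rule: edgesT_edgesL.induct)
  case (2 k s ts)
  have "({k} \<union> {Suc k..<Suc k + degF ts}) \<times> {Suc k..<Suc k + degF ts}
      \<subseteq> {k..<k + deg (Node s ts)} \<times> {k..<k + deg (Node s ts)}"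
    by auto
  with 2 show ?case unfolding edgesT.simps by (rule subset_trans)
next
  case (4 p k t ts)
  let ?R = "({p} \<union> {k..<k + degF (t # ts)}) \<times> {k..<k + degF (t # ts)}"
  have "edgesT k t \<subseteq> ?R"
    by (rule subset_trans[OF 4(1)]) auto
  moreover have "edgesL p (k + deg t) ts \<subseteq> ?R"
    by (rule subset_trans[OF 4(2)]) auto
  moreover have "(if t = Bot then {} else {(p, k)}) \<subseteq> ?R"
    by (cases t) auto
  ultimately show ?case unfolding edgesL.simps by (intro Un_least)
qed auto

lemma edgesF_range: "edgesF k f \<subseteq> {k..<k + degF f} \<times> {k..<k + degF f}"
proof (induction f arbitrary: k)
  case (Cons t f)
  have "edgesT k t \<subseteq> {k..<k + degF (t # f)} \<times> {k..<k + degF (t # f)}"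
    using edges_range(1)[of k t] by fastforce
  moreover have "edgesF (k + deg t) f \<subseteq> {k..<k + degF (t # f)} \<times> {k..<k + degF (t # f)}"
    using Cons[of "k + deg t"] by fastforce
  ultimately show ?case by simp
qed simp

lemma up_closed_empty:
  fixes t :: "'s trm" and ts :: "'s trm list"
  shows "up_closed (edgesT k t) I \<Longrightarrow> k \<notin> I \<Longrightarrow> I \<inter> {k..<k + deg t} = {}"
    and "up_closed (edgesL p k ts) I \<Longrightarrow> p \<notin> I \<Longrightarrow> I \<inter> {k..<k + degF ts} = {}"
proof (induction k t and p k ts rule: edgesT_edgesL.induct)
  case (2 k s ts)
  have "{k..<k + deg (Node s ts)} = insert k {Suc k..<Suc k + degF ts}" by auto
  with 2 show ?case by simp
next
  case (4 p k t ts)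
  have "{k..<k + degF (t # ts)} = {k..<k + deg t} \<union> {k + deg t..<k + deg t + degF ts}" by auto
  moreover have "I \<inter> {k..<k + deg t} = {}"
    using 4 by (cases t) auto
  ultimately show ?case using 4 by (simp add: Int_Un_distrib)
qed auto

lemma up_closed_edgesL: "p \<in> I \<Longrightarrow> up_closed (edgesL p k ts) I = up_closed (edgesF k ts) I"
  by (induction ts arbitrary: k) auto

lemma up_closed_cong:
  "E \<subseteq> A \<times> A \<Longrightarrow> I \<inter> A = J \<inter> A \<Longrightarrow> up_closed E I = up_closed E J"
  unfolding up_closed_def by blast

text \<open>If the root is missing, closure under ancestors empties the whole tree; if it is
  present, the edges leaving it impose nothing, and what remains is a closed set of the forest of
  children. Successive trees are independent because their numbers fill disjoint intervals.\<close>

lemma set_id: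
  fixes t :: "'s trm" and ts :: "'s trm list"
  shows "set (idT k t) = {I. I \<subseteq> {k..<k + deg t} \<and> up_closed (edgesT k t) I}"
    and "set (idL k ts) = {I. I \<subseteq> {k..<k + degF ts} \<and> up_closed (edgesF k ts) I}"
proof (induction k t and k ts rule: idT_idL.induct)
  case (2 k s ts)
  show ?case (is "?L = ?R")
  proof (intro subset_antisym subsetI)
    fix I assume "I \<in> ?L"
    moreover have "up_closed (edgesL k (Suc k) ts) {}" by (simp add: up_closed_def)
    moreover have "insert k J \<in> ?R" if J: "J \<in> set (idL (Suc k) ts)" for J
    proof -
      have "J \<subseteq> {Suc k..<Suc k + degF ts}" "up_closed (edgesF (Suc k) ts) J"
        using J 2 by auto
      moreover have "up_closed (edgesF (Suc k) ts) (insert k J) = up_closed (edgesF (Suc k) ts) J"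
        using edgesF_range by (rule up_closed_cong) auto
      ultimately show ?thesis by (auto simp: up_closed_edgesL)
    qed
    ultimately show "I \<in> ?R" by auto
  next
    fix I assume "I \<in> ?R"
    then have I: "I \<subseteq> {k..<k + deg (Node s ts)}" "up_closed (edgesT k (Node s ts)) I" by auto
    show "I \<in> ?L"
    proof (cases "k \<in> I")
      case False
      then show ?thesis using up_closed_empty(1)[OF I(2) False] I(1) by auto
    next
      case True
      have "up_closed (edgesF (Suc k) ts) I" using I(2) True by (simp add: up_closed_edgesL)
      moreover have "up_closed (edgesF (Suc k) ts) (I - {k}) = up_closed (edgesF (Suc k) ts) I"
        using edgesF_range by (rule up_closed_cong) auto
      moreover have "I - {k} \<subseteq> {Suc k..<Suc k + degF ts}" using I(1) by force
      ultimately have "I - {k} \<in> set (idL (Suc k) ts)" using 2 by auto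
      moreover have "I = insert k (I - {k})" using True by auto
      ultimately show ?thesis unfolding idT.simps by (metis image_eqI list.set_intros(2) list.set_map)
    qed
  qed
next
  case (4 k t ts)
  let ?A = "{k..<k + deg t}" and ?B = "{k + deg t..<k + deg t + degF ts}"
  have AB: "{k..<k + degF (t # ts)} = ?A \<union> ?B" "?A \<inter> ?B = {}" by auto
  have cl: "up_closed (edgesF k (t # ts)) (I \<union> J) \<longleftrightarrow> up_closed (edgesT k t) I \<and> up_closed (edgesF (k + deg t) ts) J"
    if "I \<subseteq> ?A" "J \<subseteq> ?B" for I J
  proof -
    have "up_closed (edgesT k t) (I \<union> J) = up_closed (edgesT k t) I"
      using edges_range(1) by (rule up_closed_cong) (use that AB in blast)
    moreover have "up_closed (edgesF (k + deg t) ts) (I \<union> J) = up_closed (edgesF (k + deg t) ts) J"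
      using edgesF_range by (rule up_closed_cong) (use that AB in blast)
    ultimately show ?thesis by simp
  qed
  show ?case (is "?L = ?R")
  proof (intro subset_antisym subsetI)
    fix K assume "K \<in> ?L"
    then obtain I J where "K = I \<union> J" "I \<in> set (idT k t)" "J \<in> set (idL (k + deg t) ts)" by auto
    then show "K \<in> ?R" using 4 cl[of I J] unfolding AB by auto
  next
    fix K assume "K \<in> ?R"
    then have K: "K \<subseteq> ?A \<union> ?B" "up_closed (edgesF k (t # ts)) K" unfolding AB by auto
    then have eq: "K = (K \<inter> ?A) \<union> (K \<inter> ?B)" by blast
    then have "K \<inter> ?A \<in> set (idT k t)" "K \<inter> ?B \<in> set (idL (k + deg t) ts)"
      using 4 cl[of "K \<inter> ?A" "K \<inter> ?B"] K(2) by auto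
    then show "K \<in> ?L" using eq unfolding idL.simps set_lprod by blast
  qed
qed auto

lemma concat_restrL: "concat (map snd (restrL I k ts)) = restrF I k ts"
  by (induction ts arbitrary: k) auto

text \<open>Restriction looks only at the numbers of its own interval. This is what allows a
  complement taken in a whole forest to be replaced by one taken in a single tree.\<close>

lemma restr_cong:
  fixes t :: "'s trm" and ts :: "'s trm list"
  shows "I \<inter> {k..<k + deg t} = J \<inter> {k..<k + deg t} \<Longrightarrow> restrT I k t = restrT J k t"
    and "I \<inter> {k..<k + degF ts} = J \<inter> {k..<k + degF ts} \<Longrightarrow> restrL I k ts = restrL J k ts"
proof (induction I k t and I k ts rule: restrT_restrL.induct)
  case (2 I k s ts)
  have eq: "{k..<k + deg (Node s ts)} = insert k {Suc k..<Suc k + degF ts}" by auto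
  have k: "k \<in> I \<longleftrightarrow> k \<in> J" using 2(2) unfolding eq by blast
  have "restrL I (Suc k) ts = restrL J (Suc k) ts"
  proof (rule 2(1))
    have "k \<notin> {Suc k..<Suc k + degF ts}" by simp
    then show "I \<inter> {Suc k..<Suc k + degF ts} = J \<inter> {Suc k..<Suc k + degF ts}"
      using 2(2) unfolding eq by blast
  qed
  then show ?case using k by simp
next
  case (4 I k t ts)
  have eq: "{k..<k + degF (t # ts)} = {k..<k + deg t} \<union> {k + deg t..<k + deg t + degF ts}" by auto
  have "restrT I k t = restrT J k t" "restrL I (k + deg t) ts = restrL J (k + deg t) ts"
    using 4 unfolding eq by blast+
  \<comment> \<open>A leaf occupies no number, so for \<open>t = Bot\<close> the number
    \<open>k\<close> already belongs to what follows and says nothing about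
    \<open>t\<close>.\<close>
  moreover have "k \<in> I \<longleftrightarrow> k \<in> J" if "t \<noteq> Bot"
  proof -
    have "k \<in> {k..<k + deg t}" using that by (cases t) auto
    then show ?thesis using 4(3) unfolding eq by blast
  qed
  ultimately show ?case by auto
qed auto

lemma restrF_cong:
  "I \<inter> {k..<k + degF ts} = J \<inter> {k..<k + degF ts} \<Longrightarrow> restrF I k ts = restrF J k ts"
  using restr_cong(2)[of I k ts J] concat_restrL by metis

lemma restr_empty:
  fixes t :: "'s trm" and ts :: "'s trm list"
  shows "restrT {} k t = []" and "restrF {} k ts = []"
proof (induction t and ts arbitrary: k and k rule: trm_induct)
  case (Node s ts)
  then show ?case by (simp add: concat_restrL)
qed auto


text \<open>A set closed under ancestors meets each subtree in the empty set or in a subtree with the same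
  root, so the restriction to it is computed without regrouping.\<close>

lemma restr_up_closed:
  fixes t :: "'s trm" and ts :: "'s trm list"
  shows "trim_wf S ar t \<Longrightarrow> up_closed (edgesT k t) I \<Longrightarrow>
      if k \<in> I then length (restrT I k t) = 1 else restrT I k t = []"
    and "K_basis S ar ts \<Longrightarrow> up_closed (edgesF k ts) I \<Longrightarrow>
      map (hd \<circ> snd) (filter fst (restrL I k ts)) = restrF I k ts \<and>
      concat (map (\<lambda>(b, r). if b then tl r else r) (restrL I k ts)) = []"
proof (induction t and ts arbitrary: k and k rule: trm_induct)
  case (Node s ts)
  show ?case
  proof (cases "k \<in> I")
    case True
    then have "up_closed (edgesF (Suc k) ts) I" using Node.prems(2) by (simp add: up_closed_edgesL)
    then show ?thesis using Node.IH Node.prems(1) True by (simp add: Let_def del: concat_eq_Nil_conv)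
  next
    case False
    have "restrT I k (Node s ts) = restrT {} k (Node s ts)"
      using up_closed_empty(1)[OF Node.prems(2) False] by (intro restr_cong(1)) simp
    then show ?thesis using False by (simp only: restr_empty if_False)
  qed
next
  case (Cons t ts)
  have ne: "t \<noteq> Bot" using Cons.prems(1) by auto
  have 1: "if k \<in> I then length (restrT I k t) = 1 else restrT I k t = []"
    using Cons.prems by (intro Cons.IH(1)) auto
  have 2: "map (hd \<circ> snd) (filter fst (restrL I (k + deg t) ts)) = restrF I (k + deg t) ts \<and>
      concat (map (\<lambda>(b, r). if b then tl r else r) (restrL I (k + deg t) ts)) = []"
    using Cons.prems by (intro Cons.IH(2)) auto
  show ?case
  proof (cases "k \<in> I")
    case True
    then obtain x where "restrT I k t = [x]" using 1 by (auto simp: length_Suc_conv)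
    then show ?thesis using 2 ne True by (simp add: o_def)
  next
    case False
    then show ?thesis using 1 2 ne by (simp add: o_def)
  qed
qed auto

lemma restrT_Node_in:
  assumes "k \<in> I" "K_basis S ar ts" "up_closed (edgesF (Suc k) ts) I"
  shows "restrT I k (Node s ts) = [Node s (restrF I (Suc k) ts)]"
  using restr_up_closed(2)[OF assms(2,3)] assms(1) by (simp add: Let_def del: concat_eq_Nil_conv)

lemma restrT_Node_notin: "k \<notin> I \<Longrightarrow> restrT I k (Node s ts) = restrF I (Suc k) ts"
  by (simp add: concat_restrL)

lemma restr_full:
  fixes t :: "'s trm" and ts :: "'s trm list"
  shows "trim_wf S ar t \<Longrightarrow> restrT UNIV k t = [t]"
    and "K_basis S ar ts \<Longrightarrow> restrF UNIV k ts = ts"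
proof (induction t and ts arbitrary: k and k rule: trm_induct)
  case (Node s ts)
  have "up_closed (edgesF (Suc k) ts) UNIV" by (auto simp: up_closed_def)
  then show ?case using restrT_Node_in[of k UNIV S ar ts s] Node by simp
qed auto

text \<open>A cut corresponds to the set of nodes of its upper part: restricting to that set gives
  the trimmed upper part, restricting to the complement gives the lower part. Since both
  enumerations follow the same recursion, the comparison is entrywise.\<close>

lemma map_restr_id:
  fixes t :: "'s trm" and ts :: "'s trm list"
  shows "trim_wf S ar t \<Longrightarrow>
      map (\<lambda>I. (restrT I k t, restrT ({k..<k + deg t} - I) k t)) (idT k t) = map (map_prod trT id) (cutT t)"
    and "K_basis S ar ts \<Longrightarrow>
      map (\<lambda>I. (restrF I k ts, restrF ({k..<k + degF ts} - I) k ts)) (idL k ts) = map (map_prod trF id) (cutL ts)"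
proof (induction t and ts arbitrary: k and k rule: trm_induct)
  case (Node s ts)
  let ?R = "\<lambda>I. (restrT I k (Node s ts), restrT ({k..<k + deg (Node s ts)} - I) k (Node s ts))"
  let ?R' = "\<lambda>I. (restrF I (Suc k) ts, restrF ({Suc k..<Suc k + degF ts} - I) (Suc k) ts)"
  have K: "K_basis S ar ts" using Node.prems by simp
  \<comment> \<open>The empty set belongs to the cut whose lower part is the whole tree; its
    complement covers every number of the tree, so the restriction to \<open>UNIV\<close> may be
    used instead.\<close>
  have "restrT ({k..<k + deg (Node s ts)} - {}) k (Node s ts) = restrT UNIV k (Node s ts)"
    by (rule restr_cong(1)) auto
  then have "?R {} = ([], [Node s ts])"
    by (simp only: restr_full(1)[OF Node.prems] restr_empty)
  moreover have "?R (insert k J) = (\<lambda>(a, b). ([Node s a], b)) (?R' J)" if J: "J \<in> set (idL (Suc k) ts)" for J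
  proof -
    have J': "J \<subseteq> {Suc k..<Suc k + degF ts}" "up_closed (edgesF (Suc k) ts) J"
      using J by (auto simp: set_id)
    have "up_closed (edgesF (Suc k) ts) (insert k J) = up_closed (edgesF (Suc k) ts) J"
      using edgesF_range by (rule up_closed_cong) auto
    then have "restrT (insert k J) k (Node s ts) = [Node s (restrF (insert k J) (Suc k) ts)]"
      using J'(2) K by (intro restrT_Node_in) auto
    moreover have "restrF (insert k J) (Suc k) ts = restrF J (Suc k) ts"
      by (rule restrF_cong) auto
    moreover have "restrT ({k..<k + deg (Node s ts)} - insert k J) k (Node s ts)
        = restrF ({k..<k + deg (Node s ts)} - insert k J) (Suc k) ts"
      by (rule restrT_Node_notin) simp
    \<comment> \<open>The root is removed together with \<open>J\<close>, so the complement is taken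
      within the interval of the children, as in the induction hypothesis.\<close>
    moreover have "{k..<k + deg (Node s ts)} - insert k J = {Suc k..<Suc k + degF ts} - J"
      using J'(1) by auto
    ultimately show ?thesis by simp
  qed
  ultimately have "map ?R (idT k (Node s ts)) = ([], [Node s ts]) # map (\<lambda>(a, b). ([Node s a], b)) (map ?R' (idL (Suc k) ts))"
    by (simp del: restrT.simps)
  also have "map ?R' (idL (Suc k) ts) = map (map_prod trF id) (cutL ts)"
    by (rule Node.IH[OF K])
  finally show ?case by (simp add: o_def case_prod_unfold map_prod_def del: restrT.simps)
next
  case (Cons t ts)
  let ?A = "{k..<k + deg t}" and ?B = "{k + deg t..<k + deg t + degF ts}"
  let ?R = "\<lambda>I. (restrF I k (t # ts), restrF ({k..<k + degF (t # ts)} - I) k (t # ts))"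
  let ?RT = "\<lambda>I. (restrT I k t, restrT (?A - I) k t)"
  let ?RL = "\<lambda>I. (restrF I (k + deg t) ts, restrF (?B - I) (k + deg t) ts)"
  have AB: "{k..<k + degF (t # ts)} = ?A \<union> ?B" "?A \<inter> ?B = {}" by auto
  have "map ?R (idL k (t # ts)) = lprod (\<lambda>I J. ?R (I \<union> J)) (idT k t) (idL (k + deg t) ts)"
    by (simp only: idL.simps map_lprod)
  also have "\<dots> = lprod (\<lambda>I J. (\<lambda>(a, b) (a', b'). (a @ a', b @ b')) (?RT I) (?RL J)) (idT k t) (idL (k + deg t) ts)"
  proof (rule lprod_cong[OF refl refl])
    fix I J assume "I \<in> set (idT k t)" "J \<in> set (idL (k + deg t) ts)"
    then have IJ: "I \<subseteq> ?A" "J \<subseteq> ?B" by (auto simp: set_id)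
    have "restrT (I \<union> J) k t = restrT I k t"
      "restrT ({k..<k + degF (t # ts)} - (I \<union> J)) k t = restrT (?A - I) k t"
      by (rule restr_cong(1), use IJ AB in blast)+
    moreover have "restrF (I \<union> J) (k + deg t) ts = restrF J (k + deg t) ts"
      "restrF ({k..<k + degF (t # ts)} - (I \<union> J)) (k + deg t) ts = restrF (?B - J) (k + deg t) ts"
      by (rule restrF_cong, use IJ AB in blast)+
    ultimately show "?R (I \<union> J) = (\<lambda>(a, b) (a', b'). (a @ a', b @ b')) (?RT I) (?RL J)"
      by (simp only: restrF.simps prod.case)
  qed
  also have "\<dots> = lcat (map ?RT (idT k t)) (map ?RL (idL (k + deg t) ts))"
    by (simp only: lcat_def lprod_map)
  also have "map ?RT (idT k t) = map (map_prod trT id) (cutT t)"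
    using Cons.prems by (intro Cons.IH(1)) simp
  also have "map ?RL (idL (k + deg t) ts) = map (map_prod trF id) (cutL ts)"
    using Cons.prems by (intro Cons.IH(2)) simp
  finally show ?case
    by (simp add: lcat_def lprod_map map_lprod case_prod_unfold del: restrF.simps)
qed auto

lemma up_closed_trancl: "up_closed (E\<^sup>+) I = up_closed E I"
proof
  assume cl: "up_closed E I"
  have "j \<in> I \<longrightarrow> i \<in> I" if "(i, j) \<in> E\<^sup>+" for i j
    using that by (induction rule: trancl_induct) (use cl in \<open>auto simp: up_closed_def\<close>)
  then show "up_closed (E\<^sup>+) I" by (auto simp: up_closed_def)
qed (auto simp: up_closed_def)

lemma admissible_iff:
  "admissible F I J \<longleftrightarrow> I \<in> set (idL 0 F) \<and> J = {0..<degF F} - I"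
proof -
  \<comment> \<open>Ancestor pairs join node numbers of \<open>F\<close> only. Hence a descendant
    that is not in \<open>I\<close> lies in \<open>J\<close>, and the condition on \<open>J\<close>
    is the contrapositive of the one on \<open>I\<close>.\<close>
  have "(edgesF 0 F)\<^sup>+ \<subseteq> {0..<degF F} \<times> {0..<degF F}"
    using edgesF_range[of 0 F] by (simp add: trancl_subset_Sigma)
  then have "admissible F I J \<longleftrightarrow> I \<inter> J = {} \<and> I \<union> J = {0..<degF F} \<and> up_closed ((edgesF 0 F)\<^sup>+) I"
    unfolding admissible_def up_closed_def lessThan_atLeast0 by fast
  then show ?thesis by (auto simp: up_closed_trancl set_id)
qed

lemma copK_eq:
  assumes "K_basis S ar F"
  shows "(copK F :: _ \<Rightarrow> 'k::comm_ring_1) = lvec (cutK F)"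
proof
  fix xy :: "'a trm list \<times> 'a trm list"
  obtain x y where xy: "xy = (x, y)" by force
  let ?h = "\<lambda>I. (restrF I 0 F, restrF ({0..<degF F} - I) 0 F)"
  have "cutK F = map (map_prod trF id) (cutL F)"
    unfolding cutK_def using cut_trimmed(2)[OF _ assms] tr_trimmed(2) by (intro map_cong) fastforce+
  also have "\<dots> = map ?h (idL 0 F)"
    using map_restr_id(2)[OF assms, of 0] by simp
  finally have "(lvec (cutK F) xy :: 'k) = of_nat (card {I \<in> set (idL 0 F). ?h I = xy})"
    by (simp only: lvec_map_eq_card[OF distinct_id(2)])
  also have "card {I \<in> set (idL 0 F). ?h I = xy}
      = card {(I1, I2). admissible F I1 I2 \<and> restrF I1 0 F = x \<and> restrF I2 0 F = y}"
    by (rule bij_betw_same_card[of "\<lambda>I. (I, {0..<degF F} - I)"])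
      (auto simp: bij_betw_def inj_on_def admissible_iff xy)
  finally show "(copK F xy :: 'k) = lvec (cutK F) xy"
    by (simp add: copK_def xy)
qed

section \<open>The kernel of the realization\<close>

text \<open>Structural recursion for \<open>compat\<close>; \<open>m\<close> is a lower bound for the root labels.\<close>

fun cpT :: "nat \<Rightarrow> 's trm \<Rightarrow> ('s \<times> nat) list \<Rightarrow> bool"
and cpL :: "nat \<Rightarrow> 's trm list \<Rightarrow> ('s \<times> nat) list \<Rightarrow> bool" where
  "cpT m Bot w \<longleftrightarrow> w = []"
| "cpT m (Node s ts) w \<longleftrightarrow> (\<exists>l w'. w = (s, l) # w' \<and> m \<le> l \<and> cpL (Suc l) ts w')"
| "cpL m [] w \<longleftrightarrow> w = []"
| "cpL m (t # ts) w \<longleftrightarrow> (\<exists>w1 w2. w = w1 @ w2 \<and> cpT m t w1 \<and> cpL m ts w2)"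

fun roots :: "nat \<Rightarrow> 's trm list \<Rightarrow> nat set" where
  "roots k [] = {}"
| "roots k (t # ts) = (if t = Bot then {} else {k}) \<union> roots (k + deg t) ts"

lemma edgesL_eq: "edgesL p k ts = edgesF k ts \<union> {p} \<times> roots k ts"
  by (induction ts arbitrary: k) auto

lemma length_labs:
  fixes t :: "'s trm" and ts :: "'s trm list"
  shows "length (labsT t) = deg t" and "length (labsF ts) = degF ts"
  by (induction t and ts rule: trm_induct) (auto simp: labsF_def)

lemma cp_length:
  fixes t :: "'s trm" and ts :: "'s trm list"
  shows "cpT m t w \<Longrightarrow> length w = deg t" and "cpL m ts w \<Longrightarrow> length w = degF ts"
  by (induction t and ts arbitrary: m w and m w rule: trm_induct) auto

definition increasing_on :: "(nat \<times> nat) set \<Rightarrow> ('s \<times> nat) list \<Rightarrow> bool" where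
  "increasing_on E w \<longleftrightarrow> (\<forall>(i, j)\<in>E. snd (w ! i) < snd (w ! j))"

lemma increasing_on_Un [simp]: "increasing_on (E \<union> E') w \<longleftrightarrow> increasing_on E w \<and> increasing_on E' w"
  by (auto simp: increasing_on_def)

text \<open>Edges refer to absolute positions, whereas the recursion splits the word. The segment
  \<open>w\<close> is therefore viewed inside \<open>u @ w @ v\<close>, with \<open>k\<close> the
  position at which it starts.\<close>

lemma cp_iff:
  fixes t :: "'s trm" and ts :: "'s trm list"
  shows "length w = deg t \<Longrightarrow> length u = k \<Longrightarrow> cpT m t w \<longleftrightarrow>
      map fst w = labsT t \<and> (t \<noteq> Bot \<longrightarrow> m \<le> snd ((u @ w @ v) ! k)) \<and> increasing_on (edgesT k t) (u @ w @ v)"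
    and "length w = degF ts \<Longrightarrow> length u = k \<Longrightarrow> cpL m ts w \<longleftrightarrow>
      map fst w = labsF ts \<and> (\<forall>r\<in>roots k ts. m \<le> snd ((u @ w @ v) ! r)) \<and> increasing_on (edgesF k ts) (u @ w @ v)"
proof (induction t and ts arbitrary: m k u v w and m k u v w rule: trm_induct)
  case Bot
  then show ?case by (simp add: increasing_on_def)
next
  case (Node s ts)
  obtain x w' where w: "w = x # w'" "length w' = degF ts"
    using Node.prems(1) by (cases w) auto
  have Wk: "(u @ w @ v) ! k = x" using w Node.prems(2) by (simp add: nth_append)
  have IH: "cpL (Suc (snd x)) ts w' \<longleftrightarrow> map fst w' = labsF ts \<and>
      (\<forall>r\<in>roots (Suc k) ts. Suc (snd x) \<le> snd ((u @ w @ v) ! r)) \<and> increasing_on (edgesF (Suc k) ts) (u @ w @ v)"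
    using Node.IH[of w' "u @ [x]" "Suc k" "Suc (snd x)" v] w Node.prems(2) by simp
  \<comment> \<open>The edges leaving the root turn into the lower bound \<open>Suc (snd x)\<close>
    for the labels of its children.\<close>
  have inc: "increasing_on (edgesT k (Node s ts)) (u @ w @ v) \<longleftrightarrow>
      increasing_on (edgesF (Suc k) ts) (u @ w @ v) \<and> (\<forall>r\<in>roots (Suc k) ts. Suc (snd x) \<le> snd ((u @ w @ v) ! r))"
    using Wk by (auto simp: edgesL_eq increasing_on_def Suc_le_eq)
  have "cpT m (Node s ts) w \<longleftrightarrow> fst x = s \<and> m \<le> snd x \<and> cpL (Suc (snd x)) ts w'"
    unfolding w(1) by (cases x) auto
  moreover have "map fst w = labsT (Node s ts) \<longleftrightarrow> fst x = s \<and> map fst w' = labsF ts"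
    unfolding w(1) by (simp add: labsF_def)
  ultimately show ?case unfolding IH inc using Wk by auto
next
  case Nil
  then show ?case by (simp add: increasing_on_def labsF_def)
next
  case (Cons t ts)
  define w1 w2 where "w1 = take (deg t) w" and "w2 = drop (deg t) w"
  have w: "w = w1 @ w2" "length w1 = deg t" "length w2 = degF ts"
    using Cons.prems(1) by (auto simp: w1_def w2_def)
  have "cpL m (t # ts) w \<longleftrightarrow> cpT m t w1 \<and> cpL m ts w2"
  proof
    assume "cpL m (t # ts) w"
    then obtain x1 x2 where x: "w = x1 @ x2" "cpT m t x1" "cpL m ts x2" by auto
    then have "x1 = w1 \<and> x2 = w2" using w cp_length(1)[OF x(2)] by auto
    then show "cpT m t w1 \<and> cpL m ts w2" using x by simp
  next
    assume "cpT m t w1 \<and> cpL m ts w2"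
    then show "cpL m (t # ts) w" using w(1) by auto
  qed
  moreover have "cpT m t w1 \<longleftrightarrow> map fst w1 = labsT t \<and> (t \<noteq> Bot \<longrightarrow> m \<le> snd ((u @ w @ v) ! k)) \<and>
      increasing_on (edgesT k t) (u @ w @ v)"
    using Cons.IH(1)[of w1 u k m "w2 @ v"] w Cons.prems(2) by simp
  moreover have "cpL m ts w2 \<longleftrightarrow> map fst w2 = labsF ts \<and> (\<forall>r\<in>roots (k + deg t) ts. m \<le> snd ((u @ w @ v) ! r)) \<and>
      increasing_on (edgesF (k + deg t) ts) (u @ w @ v)"
    using Cons.IH(2)[of w2 "u @ w1" "k + deg t" m v] w Cons.prems(2) by simp
  moreover have "map fst w = labsF (t # ts) \<longleftrightarrow> map fst w1 = labsT t \<and> map fst w2 = labsF ts"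
    using w length_labs(1)[of t] by (simp add: labsF_def)
  ultimately show ?case by auto
qed

lemma compat_iff: "compat f w \<longleftrightarrow> cpL 0 f w"
proof (cases "length w = degF f")
  case True
  then have "(\<forall>i<length w. fst (w ! i) = labsF f ! i) \<longleftrightarrow> map fst w = labsF f"
    by (auto simp: list_eq_iff_nth_eq length_labs)
  then show ?thesis
    using cp_iff(2)[of w f "[]" 0 0 "[]"] True by (simp add: compat_def increasing_on_def)
next
  case False
  then show ?thesis using cp_length(2)[of 0 f w] by (auto simp: compat_def)
qed

lemma cpL_append: "cpL m (f @ g) w \<longleftrightarrow> (\<exists>w1 w2. w = w1 @ w2 \<and> cpL m f w1 \<and> cpL m g w2)"
proof (induction f arbitrary: w)
  case (Cons t f)
  show ?case
  proof
    assume "cpL m ((t # f) @ g) w"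
    then obtain w1 w2 w3 where "w = w1 @ w2 @ w3" "cpT m t w1" "cpL m f w2" "cpL m g w3"
      using Cons by auto
    then show "\<exists>w1 w2. w = w1 @ w2 \<and> cpL m (t # f) w1 \<and> cpL m g w2"
      by (intro exI[of _ "w1 @ w2"] exI[of _ w3]) auto
  next
    assume "\<exists>w1 w2. w = w1 @ w2 \<and> cpL m (t # f) w1 \<and> cpL m g w2"
    then obtain w1 w2 w3 where "w = w1 @ w2 @ w3" "cpT m t w1" "cpL m f w2" "cpL m g w3"
      by auto
    then show "cpL m ((t # f) @ g) w" using Cons by auto
  qed
qed auto

text \<open>A leaf matches the empty word only, so deleting it does not affect how a word can be
  split.\<close>

lemma cp_tr:
  fixes t :: "'s trm" and ts :: "'s trm list"
  shows "cpL m (trT t) w = cpT m t w" and "cpL m (trF ts) w = cpL m ts w"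
  by (induction t and ts arbitrary: m w and m w rule: trm_induct) (auto simp: cpL_append)

lemma compat_trF: "compat (trF f) w = compat f w"
  by (simp add: compat_iff cp_tr)

text \<open>The word whose letters carry the depths of the nodes. It is the pointwise least word compatible
  with the forest, and it determines a trimmed forest; this makes the images of the
  trimmed forests triangular, hence linearly independent.\<close>

fun dwT :: "nat \<Rightarrow> 's trm \<Rightarrow> ('s \<times> nat) list"
and dwL :: "nat \<Rightarrow> 's trm list \<Rightarrow> ('s \<times> nat) list" where
  "dwT m Bot = []"
| "dwT m (Node s ts) = (s, m) # dwL (Suc m) ts"
| "dwL m [] = []"
| "dwL m (t # ts) = dwT m t @ dwL m ts"

lemma cp_dw:
  fixes t :: "'s trm" and ts :: "'s trm list"
  shows "cpT m t (dwT m t)" and "cpL m ts (dwL m ts)"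
  by (induction t and ts arbitrary: m and m rule: trm_induct) auto

text \<open>The label \<open>l\<close> of a root may exceed its bound, and the children are then
  bounded by \<open>Suc l\<close>, not by \<open>Suc m\<close>; comparing two bounds
  \<open>n \<le> m\<close> absorbs this gap.\<close>

lemma dw_le:
  fixes t :: "'s trm" and ts :: "'s trm list"
  shows "cpT m t w \<Longrightarrow> n \<le> m \<Longrightarrow> list_all2 (\<lambda>x y. fst x = fst y \<and> snd x \<le> snd y) (dwT n t) w"
    and "cpL m ts w \<Longrightarrow> n \<le> m \<Longrightarrow> list_all2 (\<lambda>x y. fst x = fst y \<and> snd x \<le> snd y) (dwL n ts) w"
proof (induction t and ts arbitrary: m n w and m n w rule: trm_induct)
  case (Cons t ts)
  then show ?case by (auto intro: list_all2_appendI)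
qed auto

lemma dw_ge:
  fixes t :: "'s trm" and ts :: "'s trm list"
  shows "x \<in> set (dwT m t) \<Longrightarrow> m \<le> snd x" and "x \<in> set (dwL m ts) \<Longrightarrow> m \<le> snd x"
proof (induction t and ts arbitrary: m and m rule: trm_induct)
  case (Node s ts)
  from Node.prems show ?case using Node.IH[of "Suc m"] by auto
qed auto

lemma dwL_hd: "Bot \<notin> set ts \<Longrightarrow> dwL m ts = [] \<or> snd (hd (dwL m ts)) = m"
proof (cases ts)
  case (Cons t ts')
  then show "Bot \<notin> set ts \<Longrightarrow> dwL m ts = [] \<or> snd (hd (dwL m ts)) = m" by (cases t) auto
qed auto

text \<open>Decoding of a depth word: after a root labelled \<open>m\<close>, its descendants form
  the longest run of labels above \<open>m\<close>, and the next tree begins with label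
  \<open>m\<close> again. Leaves at the top level are excluded because they leave no trace in the
  word.\<close>

lemma takeWhile_dwL:
  assumes "Bot \<notin> set ts"
  shows "takeWhile (\<lambda>x. m < snd x) (dwL (Suc m) us @ dwL m ts) = dwL (Suc m) us"
    and "dropWhile (\<lambda>x. m < snd x) (dwL (Suc m) us @ dwL m ts) = dwL m ts"
proof -
  have "\<forall>x\<in>set (dwL (Suc m) us). m < snd x" using dw_ge(2)[of _ "Suc m" us] by fastforce
  moreover have "takeWhile (\<lambda>x. m < snd x) (dwL m ts) = []" "dropWhile (\<lambda>x. m < snd x) (dwL m ts) = dwL m ts"
    using dwL_hd[OF assms, of m] by (cases "dwL m ts"; auto)+
  ultimately show "takeWhile (\<lambda>x. m < snd x) (dwL (Suc m) us @ dwL m ts) = dwL (Suc m) us"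
    "dropWhile (\<lambda>x. m < snd x) (dwL (Suc m) us @ dwL m ts) = dwL m ts"
    by (simp_all add: takeWhile_append2 dropWhile_append2)
qed

lemma dw_inject:
  fixes t :: "'s trm" and ts :: "'s trm list"
  shows "trim_wf S ar t \<Longrightarrow> trim_wf S ar t' \<Longrightarrow> dwT m t = dwT m t' \<Longrightarrow> t = t'"
    and "K_basis S ar ts \<Longrightarrow> K_basis S ar ts' \<Longrightarrow> dwL m ts = dwL m ts' \<Longrightarrow> ts = ts'"
proof (induction t and ts arbitrary: m t' and m ts' rule: trm_induct)
  case (Node s us)
  then show ?case by (cases t') auto
next
  case Nil
  show ?case
  proof (cases ts')
    case (Cons t us)
    then show ?thesis using Nil by (cases t) auto
  qed simp
next
  case (Cons t ts)
  obtain s us where t: "t = Node s us" using Cons.prems(1) by (cases t) auto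
  obtain t' ts'' where ts': "ts' = t' # ts''" using Cons.prems(3) t by (cases ts') auto
  obtain s' us' where t': "t' = Node s' us'" using Cons.prems(2) ts' by (cases t') auto
  have eq: "s = s'" "dwL (Suc m) us @ dwL m ts = dwL (Suc m) us' @ dwL m ts''"
    using Cons.prems(3) by (auto simp: t t' ts')
  have nb: "Bot \<notin> set ts" "Bot \<notin> set ts''"
    using Cons.prems(1,2) K_basis_no_Bot[of S ar] by (auto simp: ts')
  have "dwL (Suc m) us = dwL (Suc m) us'" "dwL m ts = dwL m ts''"
    using takeWhile_dwL[OF nb(1), of m us] takeWhile_dwL[OF nb(2), of m us'] eq(2) by simp_all
  moreover from this have "t = t'"
    using Cons.prems(1,2) eq(1) by (intro Cons.IH(1)[of t' m]) (auto simp: t t' ts')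
  moreover have "ts = ts''"
    using Cons.prems(1,2) calculation by (intro Cons.IH(2)[of ts'' m]) (auto simp: ts')
  ultimately show ?case using ts' by simp
qed auto

lemma list_all2_sum_le:
  assumes "list_all2 (\<lambda>x y. fst x = fst y \<and> snd x \<le> snd y) xs ys"
  shows "sum_list (map snd xs) \<le> (sum_list (map snd ys) :: nat)"
    and "sum_list (map snd ys) \<le> sum_list (map snd xs) \<Longrightarrow> xs = ys"
proof -
  have "sum_list (map snd xs) \<le> sum_list (map snd ys) \<and>
      (sum_list (map snd ys) \<le> sum_list (map snd xs) \<longrightarrow> xs = ys)"
    using assms by (induction rule: list_all2_induct) (auto simp: prod_eq_iff)
  then show "sum_list (map snd xs) \<le> sum_list (map snd ys)"
    "sum_list (map snd ys) \<le> sum_list (map snd xs) \<Longrightarrow> xs = ys" by auto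
qed

text \<open>Choose \<open>F\<close> in the support with minimal total depth. If the depth word of
  \<open>F\<close> is compatible with some \<open>G\<close> of the support, the depth word of
  \<open>G\<close> lies pointwise below it, so minimality forces the two words, and then the two
  forests, to agree. The coefficient of this word in \<open>rmap u\<close> is therefore
  \<open>u F\<close>.\<close>

lemma rmap_inject_K:
  fixes u :: "'s trm list \<Rightarrow> 'k::comm_ring_1"
  assumes u: "u \<in> vspace (K_basis S ar)" and r: "rmap u = (\<lambda>_. 0)"
  shows "u = (\<lambda>_. 0)"
proof (rule ccontr)
  assume "u \<noteq> (\<lambda>_. 0)"
  then have ne: "vsupp u \<noteq> {}" by (auto simp: vsupp_def)
  define wt where "wt F = sum_list (map snd (dwL 0 F))" for F :: "'s trm list"
  obtain F where F: "F \<in> vsupp u" "\<And>G. G \<in> vsupp u \<Longrightarrow> wt F \<le> wt G"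
    using ex_has_least_nat[of "\<lambda>F. F \<in> vsupp u" _ wt] ne by blast
  have "compat G (dwL 0 F) \<longleftrightarrow> G = F" if G: "G \<in> vsupp u" for G
  proof
    assume "compat G (dwL 0 F)"
    then have "list_all2 (\<lambda>x y. fst x = fst y \<and> snd x \<le> snd y) (dwL 0 G) (dwL 0 F)"
      by (auto simp: compat_iff intro: dw_le(2))
    then have "dwL 0 G = dwL 0 F"
      using F(2)[OF G] by (intro list_all2_sum_le(2)) (auto simp: wt_def)
    then show "G = F" using dw_inject(2) vspaceD(2)[OF u] F(1) G by blast
  qed (simp add: compat_iff cp_dw)
  then have "rmap u (dwL 0 F) = (\<Sum>G\<in>vsupp u. if G = F then u F else 0)"
    unfolding rmap_def lext_def by (intro sum.cong) auto
  also have "\<dots> = u F" using F(1) vspaceD(1)[OF u] by simp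
  finally show False using F(1) r by (simp add: vsupp_def)
qed

lemma rmap_Psi: "finite (vsupp v) \<Longrightarrow> rmap (Psi v) = rmap (v :: 's trm list \<Rightarrow> 'k::comm_ring_1)"
  unfolding Psi_def rmap_def by (subst lext_lext) (auto simp: compat_trF)

lemma N_basis_trF: "N_basis S ar f \<Longrightarrow> K_basis S ar (trF f)"
  by (auto simp: N_basis_def intro: K_basis_tr)

lemma Psi_vspace:
  "(v :: 's trm list \<Rightarrow> 'k::comm_ring_1) \<in> vspace (N_basis S ar) \<Longrightarrow> Psi v \<in> vspace (K_basis S ar)"
  unfolding Psi_def by (erule lext_vspace) (simp add: N_basis_trF)

lemma kerR_iff:
  fixes v :: "'s trm list \<Rightarrow> 'k::comm_ring_1"
  shows "v \<in> kerR S ar \<longleftrightarrow> v \<in> vspace (N_basis S ar) \<and> Psi v = (\<lambda>_. 0)"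
proof -
  have "rmap v = (\<lambda>_. 0) \<longleftrightarrow> Psi v = (\<lambda>_. 0)" if v: "v \<in> vspace (N_basis S ar)"
  proof -
    have "rmap (\<lambda>_. 0 :: 'k) = (\<lambda>_. 0)" by (simp add: rmap_def)
    then show ?thesis
      using rmap_Psi[OF vspaceD(1)[OF v]] rmap_inject_K[OF Psi_vspace[OF v]] by metis
  qed
  then show ?thesis by (auto simp: kerR_def)
qed

section \<open>Antipodes\<close>

text \<open>Takeuchi's formula: \<open>convJ c k f\<close> lists the summands of the \<open>k\<close>-th convolution power of
  \<open>id - \<epsilon>\<close> on \<open>f\<close>, and the antipode is the alternating sum of these powers.\<close>

fun convJ :: "('a list \<Rightarrow> ('a list \<times> 'a list) list) \<Rightarrow> nat \<Rightarrow> 'a list \<Rightarrow> 'a list list" where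
  "convJ c 0 f = (if f = [] then [[]] else [])"
| "convJ c (Suc k) f = concat (map (\<lambda>(a, b). if b = [] then [] else map (\<lambda>p. p @ b) (convJ c k a)) (c f))"

lemma sum_convJ_Suc:
  "(\<Sum>p\<leftarrow>convJ c (Suc k) f. h p) = (\<Sum>(a, b)\<leftarrow>c f. if b = [] then 0 else \<Sum>p\<leftarrow>convJ c k a. h (p @ b))"
proof -
  have "(\<Sum>p\<leftarrow>concat (map (\<lambda>(a, b). if b = [] then [] else map (\<lambda>p. p @ b) (convJ c k a)) xs). h p)
      = (\<Sum>(a, b)\<leftarrow>xs. if b = [] then 0 else \<Sum>p\<leftarrow>convJ c k a. h (p @ b))" for xs
    by (induction xs) (auto simp: o_def)
  then show ?thesis by simp
qed

lemma sum_list_filter_split: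
  "(\<Sum>x\<leftarrow>xs. g x) = (\<Sum>x\<leftarrow>filter P xs. g x) + (\<Sum>x\<leftarrow>xs. if P x then 0 else g x :: 'b::comm_monoid_add)"
  by (induction xs) (auto simp: algebra_simps)

lemma alternating_telescope:
  "(\<Sum>k\<le>n. (-1) ^ k * (u k + u (Suc k))) = u 0 + (-1) ^ n * (u (Suc n) :: 'k::comm_ring_1)"
  by (induction n) (auto simp: algebra_simps)

lemma sum_list_sum_swap:
  "(\<Sum>x\<leftarrow>xs. \<Sum>k\<in>A. q k * h k x) = (\<Sum>k\<in>A. q k * (\<Sum>x\<leftarrow>xs. h k x :: 'k::comm_ring_1))"
  by (induction xs) (auto simp: sum.distrib distrib_left)

text \<open>The list form of a graded connected bialgebra, shared by both instances:
  \<open>c f\<close> lists the summands of the coproduct of \<open>f\<close>, and coassociativity is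
  expressed by testing against functions with scalar values.\<close>

locale connected_cuts =
  fixes B :: "'a list \<Rightarrow> bool" and c :: "'a list \<Rightarrow> ('a list \<times> 'a list) list"
    and d :: "'a list \<Rightarrow> nat" and cop :: "'a list \<Rightarrow> 'a list \<times> 'a list \<Rightarrow> 'k::comm_ring_1"
  assumes cop: "B f \<Longrightarrow> cop f = lvec (c f)"
    and closed: "B f \<Longrightarrow> (a, b) \<in> set (c f) \<Longrightarrow> B a \<and> B b"
    and B_append: "B a \<Longrightarrow> B b \<Longrightarrow> B (a @ b)"
    and B_Nil: "B []"
    and left_counit: "B f \<Longrightarrow> filter (\<lambda>(a, b). a = []) (c f) = [([], f)]"
    and right_counit: "B f \<Longrightarrow> filter (\<lambda>(a, b). b = []) (c f) = [(f, [])]"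
    and degree: "B f \<Longrightarrow> (a, b) \<in> set (c f) \<Longrightarrow> d a + d b = d f"
    and degree_0: "B f \<Longrightarrow> d f = 0 \<Longrightarrow> f = []"
    and coassoc: "B f \<Longrightarrow> (\<Sum>(a, b)\<leftarrow>c f. \<Sum>(a1, a2)\<leftarrow>c a. g a1 a2 b :: 'k)
        = (\<Sum>(a, b)\<leftarrow>c f. \<Sum>(b1, b2)\<leftarrow>c b. g a b1 b2)"
begin

lemma sum_split_right:
  "B f \<Longrightarrow> (\<Sum>(a, b)\<leftarrow>c f. g a b) = g f [] + (\<Sum>(a, b)\<leftarrow>c f. if b = [] then 0 else g a b :: 'k)"
  using sum_list_filter_split[of "\<lambda>p. g (fst p) (snd p)" "c f" "\<lambda>p. snd p = []"] right_counit[of f]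
  by (simp add: case_prod_unfold)

lemma sum_split_left:
  "B f \<Longrightarrow> (\<Sum>(a, b)\<leftarrow>c f. g a b) = g [] f + (\<Sum>(a, b)\<leftarrow>c f. if a = [] then 0 else g a b :: 'k)"
  using sum_list_filter_split[of "\<lambda>p. g (fst p) (snd p)" "c f" "\<lambda>p. fst p = []"] left_counit[of f]
  by (simp add: case_prod_unfold)

text \<open>\<open>convJ\<close> splits off the last factor, but the right antipode equation needs
  the first one split off. Passing between the two is associativity of convolution, inherited from
  coassociativity.\<close>

lemma sum_convJ_Suc':
  "B f \<Longrightarrow> (\<Sum>p\<leftarrow>convJ c (Suc k) f. h p)
    = (\<Sum>(a, b)\<leftarrow>c f. if a = [] then 0 else \<Sum>p\<leftarrow>convJ c k b. h (a @ p) :: 'k)"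
proof (induction k arbitrary: f h)
  case 0
  let ?L = "\<lambda>a b. if b = [] then 0 else \<Sum>p\<leftarrow>convJ c 0 a. h (p @ b)"
  let ?R = "\<lambda>a b. if a = [] then 0 else \<Sum>p\<leftarrow>convJ c 0 b. h (a @ p)"
  \<comment> \<open>For \<open>k = 0\<close> only the summand \<open>([], f)\<close> can survive on
    the left and only \<open>(f, [])\<close> on the right; both contribute \<open>h f\<close> if
    \<open>f\<close> is nonempty, and nothing otherwise.\<close>
  have "(\<Sum>(a, b)\<leftarrow>c f. if a = [] then 0 else ?L a b) = (\<Sum>(a, b)\<leftarrow>c f. 0)"
    by (rule sum_list_cong_prod) simp
  moreover have "(\<Sum>(a, b)\<leftarrow>c f. if b = [] then 0 else ?R a b) = (\<Sum>(a, b)\<leftarrow>c f. 0)"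
    by (rule sum_list_cong_prod) simp
  ultimately have "(\<Sum>(a, b)\<leftarrow>c f. ?L a b) = (\<Sum>(a, b)\<leftarrow>c f. ?R a b)"
    unfolding sum_split_left[OF 0, of ?L] sum_split_right[OF 0, of ?R] by simp
  then show ?case unfolding sum_convJ_Suc .
next
  case (Suc k)
  \<comment> \<open>Triple cuts with nonempty outer layers; the middle layer is governed by
    \<open>convJ c k\<close> itself.\<close>
  let ?g = "\<lambda>a1 a2 b. if a1 = [] \<or> b = [] then 0 else \<Sum>p\<leftarrow>convJ c k a2. h (a1 @ p @ b)"
  have "(\<Sum>p\<leftarrow>convJ c (Suc (Suc k)) f. h p)
      = (\<Sum>(a, b)\<leftarrow>c f. if b = [] then 0 else \<Sum>p\<leftarrow>convJ c (Suc k) a. h (p @ b))"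
    by (rule sum_convJ_Suc)
  also have "\<dots> = (\<Sum>(a, b)\<leftarrow>c f. \<Sum>(a1, a2)\<leftarrow>c a. ?g a1 a2 b)"
  proof (rule sum_list_cong_prod)
    fix a b assume "(a, b) \<in> set (c f)"
    then have "B a" using closed Suc.prems by blast
    then show "(if b = [] then 0 else \<Sum>p\<leftarrow>convJ c (Suc k) a. h (p @ b)) = (\<Sum>(a1, a2)\<leftarrow>c a. ?g a1 a2 b)"
      using Suc.IH[of a "\<lambda>p. h (p @ b)"] by (cases "b = []") (auto simp: case_prod_unfold simp del: convJ.simps cong: if_cong)
  qed
  also have "\<dots> = (\<Sum>(a, b)\<leftarrow>c f. \<Sum>(b1, b2)\<leftarrow>c b. ?g a b1 b2)"
    by (rule coassoc[OF Suc.prems])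
  also have "\<dots> = (\<Sum>(a, b)\<leftarrow>c f. if a = [] then 0 else \<Sum>p\<leftarrow>convJ c (Suc k) b. h (a @ p))"
  proof (rule sum_list_cong_prod)
    fix a b
    show "(\<Sum>(b1, b2)\<leftarrow>c b. ?g a b1 b2) = (if a = [] then 0 else \<Sum>p\<leftarrow>convJ c (Suc k) b. h (a @ p))"
      unfolding sum_convJ_Suc by (cases "a = []") (auto simp: case_prod_unfold)
  qed
  finally show ?case .
qed

lemma convJ_B: "B f \<Longrightarrow> p \<in> set (convJ c k f) \<Longrightarrow> B p"
proof (induction k arbitrary: f p)
  case 0
  then show ?case by (auto simp: B_Nil split: if_splits)
next
  case (Suc k)
  from Suc.prems(2) obtain a b q where "(a, b) \<in> set (c f)" "q \<in> set (convJ c k a)" "p = q @ b"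
    by (auto split: if_splits)
  then show ?case using Suc.IH closed[OF Suc.prems(1)] B_append by blast
qed

text \<open>Each factor is nonempty and hence of positive degree, so at most \<open>d f\<close>
  factors fit. This local nilpotency makes Takeuchi's sum finite.\<close>

lemma convJ_Nil: "B f \<Longrightarrow> d f < k \<Longrightarrow> convJ c k f = []"
proof (induction k arbitrary: f)
  case (Suc k)
  have "convJ c k a = []" if ab: "(a, b) \<in> set (c f)" and "b \<noteq> []" for a b
  proof -
    have "d b \<noteq> 0" using degree_0 closed[OF Suc.prems(1) ab] \<open>b \<noteq> []\<close> by blast
    then show ?thesis
      using Suc.IH[of a] closed[OF Suc.prems(1) ab] degree[OF Suc.prems(1) ab] Suc.prems(2) by simp
  qed
  then show ?case by auto
qed simp

definition antip :: "'a list \<Rightarrow> 'a list \<Rightarrow> 'k" where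
  "antip f z = (\<Sum>k\<le>d f. (-1) ^ k * lvec (convJ c k f) z)"

lemma antip_vspace: "B f \<Longrightarrow> antip f \<in> vspace B"
proof (rule vspaceI)
  fix z assume f: "B f" and nz: "antip f z \<noteq> 0"
  then obtain k where "k \<le> d f" "lvec (convJ c k f) z \<noteq> (0 :: 'k)"
    unfolding antip_def by (metis (mono_tags, lifting) atMost_iff mult_zero_right sum.neutral)
  then have "k \<le> d f" "z \<in> set (convJ c k f)"
    using vsupp_lvec[of "convJ c k f"] by (auto simp: vsupp_def)
  then show "z \<in> (\<Union>k\<le>d f. set (convJ c k f)) \<and> B z"
    using convJ_B[OF f] by auto
qed simp

text \<open>The vanishing of higher powers permits any upper limit \<open>n \<ge> d f\<close>, so
  the antipodes of all parts of one forest can be written with a common range.\<close>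

lemma lext_antip:
  assumes "B f" "d f \<le> n"
  shows "lext g (antip f) z = (\<Sum>k\<le>n. (-1) ^ k * (\<Sum>p\<leftarrow>convJ c k f. g p z))"
proof -
  have "antip f = (\<lambda>z. \<Sum>k\<le>n. (-1) ^ k * lvec (convJ c k f) z)"
    unfolding antip_def using assms convJ_Nil
    by (intro ext sum.mono_neutral_left) auto
  then show ?thesis
    using lext_sum(2)[of "{..n}" "\<lambda>k. lvec (convJ c k f)" g "\<lambda>k. (-1) ^ k" z] by (simp add: lext_lvec)
qed

text \<open>With \<open>J\<close> for the identity minus the counit, convolving the
  \<open>k\<close>-th power of \<open>J\<close> with the identity gives the \<open>k\<close>-th plus
  the next power. The alternating sum telescopes to the zeroth power, the counit, since power
  \<open>Suc (d f)\<close> vanishes on \<open>f\<close>.\<close>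

lemma antip_left:
  assumes "B f"
  shows "(\<Sum>(a, b)\<leftarrow>c f. cat_mul (antip a) (bvec b) z) = (if f = [] then bvec [] z else 0)"
proof -
  define u where "u k = (\<Sum>p\<leftarrow>convJ c k f. bvec p z :: 'k)" for k
  have "(\<Sum>(a, b)\<leftarrow>c f. cat_mul (antip a) (bvec b) z)
      = (\<Sum>(a, b)\<leftarrow>c f. \<Sum>k\<le>d f. (-1) ^ k * (\<Sum>p\<leftarrow>convJ c k a. bvec (p @ b) z))"
  proof (rule sum_list_cong_prod)
    fix a b assume "(a, b) \<in> set (c f)"
    then have "B a" "d a \<le> d f" using closed[OF assms] degree[OF assms] by fastforce+
    then show "cat_mul (antip a) (bvec b) z = (\<Sum>k\<le>d f. (-1) ^ k * (\<Sum>p\<leftarrow>convJ c k a. bvec (p @ b) z))"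
      by (simp add: cat_mul_bvec_right lext_antip)
  qed
  also have "\<dots> = (\<Sum>k\<le>d f. (-1) ^ k * (\<Sum>(a, b)\<leftarrow>c f. \<Sum>p\<leftarrow>convJ c k a. bvec (p @ b) z))"
    unfolding case_prod_unfold by (rule sum_list_sum_swap)
  also have "\<dots> = (\<Sum>k\<le>d f. (-1) ^ k * (u k + u (Suc k)))"
    using sum_split_right[OF assms, of "\<lambda>a b. \<Sum>p\<leftarrow>convJ c _ a. bvec (p @ b) z"]
    by (simp only: u_def sum_convJ_Suc append_Nil2)
  also have "\<dots> = u 0 + (-1) ^ d f * u (Suc (d f))"
    by (rule alternating_telescope)
  also have "u (Suc (d f)) = 0"
    using convJ_Nil[OF assms, of "Suc (d f)"] by (simp add: u_def del: convJ.simps)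
  finally show ?thesis by (simp add: u_def)
qed

lemma antip_right:
  assumes "B f"
  shows "(\<Sum>(a, b)\<leftarrow>c f. cat_mul (bvec a) (antip b) z) = (if f = [] then bvec [] z else 0)"
proof -
  define u where "u k = (\<Sum>p\<leftarrow>convJ c k f. bvec p z :: 'k)" for k
  have "(\<Sum>(a, b)\<leftarrow>c f. cat_mul (bvec a) (antip b) z)
      = (\<Sum>(a, b)\<leftarrow>c f. \<Sum>k\<le>d f. (-1) ^ k * (\<Sum>p\<leftarrow>convJ c k b. bvec (a @ p) z))"
  proof (rule sum_list_cong_prod)
    fix a b assume "(a, b) \<in> set (c f)"
    then have "B b" "d b \<le> d f" using closed[OF assms] degree[OF assms] by fastforce+
    then show "cat_mul (bvec a) (antip b) z = (\<Sum>k\<le>d f. (-1) ^ k * (\<Sum>p\<leftarrow>convJ c k b. bvec (a @ p) z))"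
      by (simp add: cat_mul_bvec_left lext_antip)
  qed
  also have "\<dots> = (\<Sum>k\<le>d f. (-1) ^ k * (\<Sum>(a, b)\<leftarrow>c f. \<Sum>p\<leftarrow>convJ c k b. bvec (a @ p) z))"
    unfolding case_prod_unfold by (rule sum_list_sum_swap)
  also have "\<dots> = (\<Sum>k\<le>d f. (-1) ^ k * (u k + u (Suc k)))"
    using sum_split_left[OF assms, of "\<lambda>a b. \<Sum>p\<leftarrow>convJ c _ b. bvec (a @ p) z"]
    by (simp only: u_def sum_convJ_Suc'[OF assms] append_Nil)
  also have "\<dots> = u 0 + (-1) ^ d f * u (Suc (d f))"
    by (rule alternating_telescope)
  also have "u (Suc (d f)) = 0"
    using convJ_Nil[OF assms, of "Suc (d f)"] by (simp add: u_def del: convJ.simps)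
  finally show ?thesis by (simp add: u_def)
qed

lemma is_antipode_antip: "is_antipode B cop antip"
  unfolding is_antipode_def
  by (auto simp: antip_vspace cop lext_lvec fun_eq_iff case_prod_unfold
      antip_left[unfolded case_prod_unfold] antip_right[unfolded case_prod_unfold])

end

lemma N_basis_no_Bot: "N_basis S ar f \<Longrightarrow> Bot \<notin> set f"
  by (auto simp: N_basis_def)

lemma connected_cuts_N:
  "connected_cuts (N_basis S ar) cutN degF (copN S ar :: _ \<Rightarrow> _ \<Rightarrow> 'k::comm_ring_1)"
proof
  show "N_basis S ar a \<Longrightarrow> N_basis S ar b \<Longrightarrow> N_basis S ar (a @ b)" "N_basis S ar []" for a b
    by (auto simp: N_basis_def)
qed (simp_all only: copN_eq cutN_props filter_cutN_Nil N_basis_no_Bot degF_eq_0 cutN_coassoc not_False_eq_True simp_thms)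

lemma connected_cuts_K:
  "connected_cuts (K_basis S ar) cutK degF (copK :: _ \<Rightarrow> _ \<Rightarrow> 'k::comm_ring_1)"
proof
  show "K_basis S ar f \<Longrightarrow> (a, b) \<in> set (cutK f) \<Longrightarrow> K_basis S ar a \<and> K_basis S ar b" for f a b
    by (rule cutK_props(2))
  show "K_basis S ar f \<Longrightarrow> copK f = (lvec (cutK f) :: _ \<Rightarrow> 'k)" for f
    by (rule copK_eq)
  show "K_basis S ar f \<Longrightarrow> filter (\<lambda>(a, b). a = []) (cutK f) = [([], f)]"
    "K_basis S ar f \<Longrightarrow> filter (\<lambda>(a, b). b = []) (cutK f) = [(f, [])]" for f
    by (rule filter_cutK_Nil; assumption)+
  show "K_basis S ar f \<Longrightarrow> degF f = 0 \<Longrightarrow> f = []" for f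
    by (rule degF_eq_0[OF _ K_basis_no_Bot])
qed (simp_all add: cutK_props cutK_coassoc)

section \<open>The isomorphism\<close>

lemma lext_bvec_id:
  fixes u :: "'a \<Rightarrow> 'k::comm_ring_1"
  assumes "finite (vsupp u)"
  shows "lext bvec u = u"
proof
  fix y
  have "lext bvec u y = (\<Sum>x\<in>vsupp u. if x = y then u y else 0)"
    unfolding lext_def by (intro sum.cong) (auto simp: bvec_def)
  then show "lext bvec u y = u y" using assms by (auto simp: vsupp_def)
qed

lemma cat_mul_vspace:
  fixes u v :: "'a list \<Rightarrow> 'k::comm_ring_1"
  assumes "u \<in> vspace B" "v \<in> vspace B" "\<And>a b. B a \<Longrightarrow> B b \<Longrightarrow> B (a @ b)"
  shows "cat_mul u v \<in> vspace B"
  unfolding cat_mul_def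
  by (rule lext_vspace[OF assms(1)], rule lext_vspace[OF assms(2)], rule bvec_vspace, rule assms(3))

lemma N_basis_append: "N_basis S ar a \<Longrightarrow> N_basis S ar b \<Longrightarrow> N_basis S ar (a @ b)"
  by (auto simp: N_basis_def)

section \<open>Trimming as a morphism of bialgebras\<close>

lemma Psi_bvec [simp]: "Psi (bvec f :: 's trm list \<Rightarrow> 'k::comm_ring_1) = bvec (trF f)"
  by (simp add: Psi_def)

lemma Psi_zero [simp]: "Psi (\<lambda>_. 0) = (\<lambda>_. 0)"
  by (simp add: Psi_def)

lemma Psi_lext:
  fixes h :: "'a \<Rightarrow> 's trm list \<Rightarrow> 'k::comm_ring_1"
  assumes "finite (vsupp v)" "\<And>x. x \<in> vsupp v \<Longrightarrow> finite (vsupp (h x))"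
  shows "Psi (lext h v) = lext (\<lambda>x. Psi (h x)) v"
  unfolding Psi_def by (rule lext_lext[OF assms])

lemma lext_Psi:
  fixes v :: "'s trm list \<Rightarrow> 'k::comm_ring_1"
  assumes "finite (vsupp v)"
  shows "lext g (Psi v) = lext (\<lambda>f. g (trF f)) v"
  unfolding Psi_def using assms by (subst lext_lext) auto

lemma Psi_cat_mul:
  fixes v w :: "'s trm list \<Rightarrow> 'k::comm_ring_1"
  assumes "finite (vsupp v)" "finite (vsupp w)"
  shows "Psi (cat_mul v w) = cat_mul (Psi v) (Psi w)"
proof -
  have "Psi (cat_mul v w) = lext (\<lambda>a. lext (\<lambda>b. bvec (trF a @ trF b)) w) v"
    unfolding cat_mul_def using assms by (simp add: Psi_lext finite_vsupp_lext)
  also have "\<dots> = cat_mul (Psi v) (Psi w)"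
    unfolding cat_mul_def using assms by (simp add: lext_Psi)
  finally show ?thesis .
qed

lemma trF_eq_Nil_N: "N_basis S ar f \<Longrightarrow> trF f = [] \<longleftrightarrow> f = []"
  using N_basis_no_Bot[of S ar f] rd_eq_self_iff[of f] by (simp add: trF_eq_Nil_iff)

lemma Psi_counit:
  fixes v :: "'s trm list \<Rightarrow> 'k::comm_ring_1"
  assumes "v \<in> vspace (N_basis S ar)"
  shows "Psi v [] = v []"
proof -
  have "Psi v [] = (\<Sum>f\<in>vsupp v. if f = [] then v [] else 0)"
    unfolding Psi_def lext_def using trF_eq_Nil_N[OF vspaceD(2)[OF assms]]
    by (intro sum.cong) (auto simp: bvec_def eq_commute[of "[]"])
  then show ?thesis using vspaceD(1)[OF assms] by (auto simp: vsupp_def)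
qed

text \<open>A section of trimming. Where the missing leaves of a node go is a free choice; here they
  all stand to the right of the children.\<close>

fun padT :: "('s \<Rightarrow> nat) \<Rightarrow> 's trm \<Rightarrow> 's trm" where
  "padT ar Bot = Bot"
| "padT ar (Node s ts) = Node s (map (padT ar) ts @ replicate (ar s - length ts) Bot)"

lemma trF_replicate_Bot [simp]: "trF (replicate n Bot) = []"
  by (induction n) auto

lemma pad_props:
  fixes t :: "'s trm" and ts :: "'s trm list"
  shows "trim_wf S ar t \<Longrightarrow> trT (padT ar t) = [t] \<and> wf_trm S ar (padT ar t) \<and> padT ar t \<noteq> Bot"
    and "K_basis S ar ts \<Longrightarrow> trF (map (padT ar) ts) = ts \<and> N_basis S ar (map (padT ar) ts)"
proof (induction t and ts rule: trm_induct)
  case (Node s ts)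
  then show ?case by (auto simp: N_basis_def)
qed (auto simp: N_basis_def)

lemma Psi_surj:
  fixes u :: "'s trm list \<Rightarrow> 'k::comm_ring_1"
  assumes "u \<in> vspace (K_basis S ar)"
  shows "\<exists>v\<in>vspace (N_basis S ar). Psi v = u"
proof
  let ?v = "lext (\<lambda>F. bvec (map (padT ar) F)) u"
  show "?v \<in> vspace (N_basis S ar)"
    using assms by (rule lext_vspace) (simp add: pad_props)
  have "Psi ?v = lext (\<lambda>F. bvec (trF (map (padT ar) F))) u"
    using vspaceD(1)[OF assms] by (simp add: Psi_lext)
  also have "\<dots> = lext bvec u"
    using vspaceD(2)[OF assms] by (intro lext_cong) (metis pad_props(2))
  also have "\<dots> = u"
    by (rule lext_bvec_id[OF vspaceD(1)[OF assms]])
  finally show "Psi ?v = u" .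
qed

lemma Psi_cop:
  fixes v :: "'s trm list \<Rightarrow> 'k::comm_ring_1"
  assumes "v \<in> vspace (N_basis S ar)"
  shows "lext copK (Psi v) = lext (\<lambda>(a, b). bvec (trF a, trF b)) (lext (copN S ar) v)"
proof -
  have eq: "copK (trF f) = lext (\<lambda>(a, b). bvec (trF a, trF b)) (copN S ar f :: _ \<Rightarrow> 'k)"
    if f: "N_basis S ar f" for f
  proof -
    have "copK (trF f) = (lvec (map (map_prod trF trF) (cutN f)) :: _ \<Rightarrow> 'k)"
      using copK_eq[OF N_basis_trF[OF f]] by (simp add: cutK_trF cutK_eq_map_cutN)
    also have "\<dots> = lext (\<lambda>(a, b). bvec (trF a, trF b)) (lvec (cutN f))"
      by (rule ext, simp add: lext_lvec) (simp add: lvec_def o_def case_prod_unfold map_prod_def)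
    finally show ?thesis by (simp add: copN_eq[OF f])
  qed
  have fin: "finite (vsupp (copN S ar f :: _ \<Rightarrow> 'k))" if "f \<in> vsupp v" for f
    by (simp add: copN_eq[OF vspaceD(2)[OF assms that]])
  have "lext copK (Psi v) = lext (\<lambda>f. copK (trF f)) v"
    using vspaceD(1)[OF assms] by (rule lext_Psi)
  also have "\<dots> = lext (\<lambda>f. lext (\<lambda>(a, b). bvec (trF a, trF b)) (copN S ar f)) v"
    using vspaceD(2)[OF assms] by (intro lext_cong eq)
  also have "\<dots> = lext (\<lambda>(a, b). bvec (trF a, trF b)) (lext (copN S ar) v)"
    using vspaceD(1)[OF assms] fin by (rule lext_lext[symmetric])
  finally show ?thesis .
qed

lemma cat_mul_Nil_right:
  fixes u :: "'a list \<Rightarrow> 'k::comm_ring_1"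
  assumes "finite (vsupp u)"
  shows "cat_mul u (bvec []) = u"
  using lext_bvec_id[OF assms] by (simp add: cat_mul_bvec_right)

text \<open>In a connected bialgebra the left antipode equation determines the antipode by
  recursion on the degree.\<close>

lemma Psi_antipode:
  fixes S1 S2 :: "'s trm list \<Rightarrow> 's trm list \<Rightarrow> 'k::comm_ring_1"
  assumes S1: "is_antipode (N_basis S ar) (copN S ar) S1" and S2: "is_antipode (K_basis S ar) copK S2"
  shows "N_basis S ar f \<Longrightarrow> Psi (S1 f) = S2 (trF f)"
proof (induction "degF f" arbitrary: f rule: less_induct)
  case less
  interpret N: connected_cuts "N_basis S ar" cutN degF "copN S ar :: _ \<Rightarrow> _ \<Rightarrow> 'k"
    by (rule connected_cuts_N)
  have K: "K_basis S ar (trF f)" by (rule N_basis_trF[OF less.prems])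
  have fin1: "finite (vsupp (S1 a))" if "N_basis S ar a" for a
    using S1 that by (auto simp: is_antipode_def dest: vspaceD)
  have fin2: "finite (vsupp (S2 a))" if "K_basis S ar a" for a
    using S2 that by (auto simp: is_antipode_def dest: vspaceD)
  have cutN_in: "N_basis S ar a" "N_basis S ar b" if "(a, b) \<in> set (cutN f)" for a b
    using N.closed[OF less.prems that] by auto
  let ?e = "if f = [] then bvec [] else (\<lambda>_. 0 :: 'k)"
  let ?A = "\<lambda>a b. cat_mul (Psi (S1 a)) (bvec (trF b))"
  let ?B = "\<lambda>a b. cat_mul (S2 (trF a)) (bvec (trF b))"
  show ?case
  proof
    fix z
    have "lext (\<lambda>(a, b). cat_mul (S1 a) (bvec b)) (lvec (cutN f)) = ?e"
      using S1 less.prems by (simp add: is_antipode_def copN_eq)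
    then have "Psi ?e = Psi (lext (\<lambda>(a, b). cat_mul (S1 a) (bvec b)) (lvec (cutN f)))"
      by simp
    also have "\<dots> = lext (\<lambda>p. Psi (case p of (a, b) \<Rightarrow> cat_mul (S1 a) (bvec b))) (lvec (cutN f))"
    proof (rule Psi_lext)
      fix p assume "p \<in> vsupp (lvec (cutN f) :: _ \<Rightarrow> 'k)"
      then have "p \<in> set (cutN f)" by (rule subsetD[OF vsupp_lvec])
      then have "finite (vsupp (S1 (fst p)))" using fin1 cutN_in(1)[of "fst p" "snd p"] by simp
      then show "finite (vsupp (case p of (a, b) \<Rightarrow> cat_mul (S1 a) (bvec b)))"
        by (auto simp: cat_mul_bvec_right case_prod_unfold intro: finite_vsupp_lext)
    qed simp
    finally have "Psi ?e z = (\<Sum>p\<leftarrow>cutN f. Psi (case p of (a, b) \<Rightarrow> cat_mul (S1 a) (bvec b)) z)"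
      by (simp add: lext_lvec)
    also have "\<dots> = (\<Sum>(a, b)\<leftarrow>cutN f. ?A a b z)"
      using Psi_cat_mul[OF fin1[OF cutN_in(1)] finite_vsupp_bvec]
      by (intro arg_cong[of _ _ sum_list] map_cong) auto
    finally have 1: "(\<Sum>(a, b)\<leftarrow>cutN f. ?A a b z) = Psi ?e z" by simp
    have "lext (\<lambda>(a, b). cat_mul (S2 a) (bvec b)) (copK (trF f)) = (if trF f = [] then bvec [] else (\<lambda>_. 0))"
      using S2 K unfolding is_antipode_def by blast
    also have "copK (trF f) = (lvec (cutK f) :: _ \<Rightarrow> 'k)"
      by (simp only: copK_eq[OF K] cutK_trF)
    also have "(if trF f = [] then bvec [] else (\<lambda>_. 0)) = Psi ?e"
      by (simp add: trF_eq_Nil_N[OF less.prems])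
    finally have "lext (\<lambda>(a, b). cat_mul (S2 a) (bvec b)) (lvec (cutK f)) = Psi ?e" .
    moreover have "lext (\<lambda>(a, b). cat_mul (S2 a) (bvec b)) (lvec (cutK f)) z = (\<Sum>(a, b)\<leftarrow>cutN f. ?B a b z)"
      unfolding cutK_eq_map_cutN[symmetric] lext_lvec by (simp add: o_def case_prod_unfold)
    ultimately have 2: "(\<Sum>(a, b)\<leftarrow>cutN f. ?B a b z) = Psi ?e z" by simp
    \<comment> \<open>A nonempty \<open>b\<close> has positive degree, so \<open>a\<close> has
      smaller degree than \<open>f\<close> and the induction hypothesis applies. Cancelling these
      summands leaves only \<open>(f, [])\<close>, which carries the antipode of \<open>f\<close>
      itself.\<close>
    have "(\<Sum>(a, b)\<leftarrow>cutN f. if b = [] then 0 else ?A a b z) = (\<Sum>(a, b)\<leftarrow>cutN f. if b = [] then 0 else ?B a b z)"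
    proof (rule sum_list_cong_prod)
      fix a b assume ab: "(a, b) \<in> set (cutN f)"
      have "Psi (S1 a) = S2 (trF a)" if "b \<noteq> []"
      proof (rule less.hyps)
        have "degF b \<noteq> 0" using N.degree_0[OF cutN_in(2)[OF ab]] that by blast
        then show "degF a < degF f" using N.degree[OF less.prems ab] by linarith
      qed (rule cutN_in(1)[OF ab])
      then show "(if b = [] then 0 else ?A a b z) = (if b = [] then 0 else ?B a b z)" by simp
    qed
    moreover have "x = y" if "x + s = e" "y + s' = e" "s = s'" for x y s s' e :: 'k
      using that by auto
    ultimately have "?A f [] z = ?B f [] z"
      using 1 2 unfolding N.sum_split_right[OF less.prems, of "\<lambda>a b. ?A a b z"]
        N.sum_split_right[OF less.prems, of "\<lambda>a b. ?B a b z"] trF_simps(1) by blast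
    moreover have "finite (vsupp (Psi (S1 f)))"
      unfolding Psi_def using fin1[OF less.prems] by (simp add: finite_vsupp_lext)
    ultimately show "Psi (S1 f) z = S2 (trF f) z"
      using fin2[OF K] by (simp add: cat_mul_Nil_right)
  qed
qed

lemma Psi_lext_antipode:
  fixes S1 S2 :: "'s trm list \<Rightarrow> 's trm list \<Rightarrow> 'k::comm_ring_1"
  assumes S1: "is_antipode (N_basis S ar) (copN S ar) S1" and S2: "is_antipode (K_basis S ar) copK S2"
    and v: "v \<in> vspace (N_basis S ar)"
  shows "Psi (lext S1 v) = lext S2 (Psi v)"
proof -
  have "finite (vsupp (S1 f))" if "f \<in> vsupp v" for f
    using S1 vspaceD(2)[OF v that] by (auto simp: is_antipode_def dest: vspaceD)
  then have "Psi (lext S1 v) = lext (\<lambda>f. Psi (S1 f)) v"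
    using vspaceD(1)[OF v] by (intro Psi_lext)
  also have "\<dots> = lext (\<lambda>f. S2 (trF f)) v"
    using vspaceD(2)[OF v] by (intro lext_cong Psi_antipode[OF S1 S2])
  also have "\<dots> = lext S2 (Psi v)"
    using vspaceD(1)[OF v] by (rule lext_Psi[symmetric])
  finally show ?thesis .
qed

section \<open>The kernel as a Hopf ideal\<close>

lemma in_span_add_generator:
  assumes "in_span A v" "g \<in> A"
  shows "in_span A (\<lambda>x. v x + c * g x)"
proof -
  obtain n :: nat and k h where "\<forall>i<n. h i \<in> A" "v = (\<lambda>x. \<Sum>i<n. k i * h i x)"
    using assms(1) unfolding in_span_def by blast
  then show ?thesis unfolding in_span_def using assms(2)
    by (intro exI[of _ "Suc n"] exI[of _ "k(n := c)"] exI[of _ "h(n := g)"]) (auto simp: less_Suc_eq)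
qed

lemma kerR_bvec_diff:
  assumes "N_basis S ar a" "N_basis S ar b" "trF a = trF b"
  shows "(\<lambda>x. bvec a x - bvec b x) \<in> (kerR S ar :: ('s trm list \<Rightarrow> 'k::comm_ring_1) set)"
proof -
  have "(\<lambda>x. bvec a x - bvec b x :: 'k) \<in> vspace (N_basis S ar)"
    by (rule vspaceI[of "{a, b}"]) (use assms in \<open>auto simp: bvec_def split: if_splits\<close>)
  moreover have "Psi (\<lambda>x. bvec a x - bvec b x :: 'k) = (\<lambda>_. 0)"
  proof
    fix z
    have "vsupp (\<lambda>x. - 1 * bvec b x :: 'k) \<subseteq> {b}" by (auto simp: vsupp_def bvec_def)
    then have "finite (vsupp (\<lambda>x. - 1 * bvec b x :: 'k))" by (rule finite_subset) simp
    then have "Psi (\<lambda>x. bvec a x + - 1 * bvec b x :: 'k) z = 0"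
      unfolding Psi_def by (subst lext_add) (simp_all only: finite_vsupp_bvec lext_scale lext_bvec assms(3), simp)
    then show "Psi (\<lambda>x. bvec a x - bvec b x :: 'k) z = 0" by simp
  qed
  ultimately show ?thesis by (simp add: kerR_iff)
qed

text \<open>With \<open>e\<close> the composite of trimming and padding,
  \<open>a \<otimes> b - e a \<otimes> e b\<close> equals
  \<open>(a - e a) \<otimes> b + e a \<otimes> (b - e b)\<close>, whose two terms \<open>t1\<close>
  and \<open>t2\<close> each have a factor in the kernel. Summed over \<open>U\<close>, the
  correction \<open>e a \<otimes> e b\<close> disappears.\<close>

lemma kernel_tensor_in_span:
  fixes U :: "'s trm list \<times> 's trm list \<Rightarrow> 'k::comm_ring_1"
  assumes U: "U \<in> vspace (\<lambda>(a, b). N_basis S ar a \<and> N_basis S ar b)"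
    and zero: "lext (\<lambda>(a, b). bvec (trF a, trF b)) U = (\<lambda>_. 0)"
  shows "in_span ({tensor a b |a b. a \<in> kerR S ar \<and> b \<in> vspace (N_basis S ar)} \<union>
      {tensor a b |a b. a \<in> vspace (N_basis S ar) \<and> b \<in> kerR S ar}) U" (is "in_span ?A U")
proof -
  define e where "e a = map (padT ar) (trF a)" for a
  have e: "N_basis S ar (e a)" "trF (e a) = trF a" if "N_basis S ar a" for a
    using pad_props(2)[OF N_basis_trF[OF that]] by (simp_all add: e_def)
  define t1 t2 where "t1 = (\<lambda>(a, b). tensor (\<lambda>x. bvec a x - bvec (e a) x) (bvec b) :: 's trm list \<times> 's trm list \<Rightarrow> 'k)"
    and "t2 = (\<lambda>(a, b). tensor (bvec (e a)) (\<lambda>x. bvec b x - bvec (e b) x) :: 's trm list \<times> 's trm list \<Rightarrow> 'k)"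
  have t: "t1 p \<in> ?A" "t2 p \<in> ?A" if "p \<in> vsupp U" for p
  proof -
    obtain a b where p: "p = (a, b)" by force
    then have N: "N_basis S ar a" "N_basis S ar b" using vspaceD(2)[OF U that] by auto
    have "(\<lambda>x. bvec a x - bvec (e a) x :: 'k) \<in> kerR S ar" "(\<lambda>x. bvec b x - bvec (e b) x :: 'k) \<in> kerR S ar"
      by (rule kerR_bvec_diff; simp add: e N)+
    moreover have "(bvec b :: _ \<Rightarrow> 'k) \<in> vspace (N_basis S ar)" "(bvec (e a) :: _ \<Rightarrow> 'k) \<in> vspace (N_basis S ar)"
      by (simp_all add: e N)
    ultimately show "t1 p \<in> ?A" "t2 p \<in> ?A"
      unfolding p t1_def t2_def prod.case by blast+
  qed
  have fin: "finite (vsupp U)" by (rule vspaceD(1)[OF U])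
  have "in_span ?A (\<lambda>y. \<Sum>p\<in>P. U p * (t1 p y + t2 p y))" if "finite P" "P \<subseteq> vsupp U" for P
    using that
  proof (induction P rule: finite_induct)
    case empty
    show ?case unfolding in_span_def by (rule exI[of _ 0]) simp
  next
    case (insert p P)
    then have "in_span ?A (\<lambda>y. ((\<Sum>p\<in>P. U p * (t1 p y + t2 p y)) + U p * t1 p y) + U p * t2 p y)"
      using t by (intro in_span_add_generator) auto
    then show ?case using insert.hyps by (simp add: algebra_simps)
  qed
  then have "in_span ?A (\<lambda>y. \<Sum>p\<in>vsupp U. U p * (t1 p y + t2 p y))"
    using fin by blast
  moreover have "(\<lambda>y. \<Sum>p\<in>vsupp U. U p * (t1 p y + t2 p y)) = U"
  proof
    fix y
    have "t1 p y + t2 p y = bvec p y - (\<lambda>(a, b). bvec (e a, e b)) p y" for p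
      by (cases p; cases y) (auto simp: t1_def t2_def tensor_def bvec_def)
    then have "(\<Sum>p\<in>vsupp U. U p * (t1 p y + t2 p y))
        = (\<Sum>p\<in>vsupp U. U p * bvec p y) - lext (\<lambda>(a, b). bvec (e a, e b)) U y"
      by (simp add: right_diff_distrib sum_subtractf lext_def)
    \<comment> \<open>The map \<open>e\<close> on both factors is trimming followed by padding, so
      it factors through the map that kills \<open>U\<close>.\<close>
    also have "lext (\<lambda>(a, b). bvec (e a, e b)) U
        = lext (\<lambda>(a, b). bvec (map (padT ar) a, map (padT ar) b)) (lext (\<lambda>(a, b). bvec (trF a, trF b)) U)"
      using fin by (subst lext_lext) (auto simp: case_prod_unfold e_def)
    also have "\<dots> = (\<lambda>_. 0)" by (simp add: zero)
    also have "(\<Sum>p\<in>vsupp U. U p * bvec p y) = U y"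
      using fun_cong[OF lext_bvec_id[OF fin], of y] by (simp add: lext_def)
    finally show "(\<Sum>p\<in>vsupp U. U p * (t1 p y + t2 p y)) = U y" by simp
  qed
  ultimately show ?thesis by simp
qed

lemma hopf_ideal_kerR:
  "hopf_ideal (N_basis S ar) (copN S ar) (kerR S ar :: ('s trm list \<Rightarrow> 'k::comm_ring_1) set)"
  unfolding hopf_ideal_def
proof (intro conjI ballI allI impI)
  interpret N: connected_cuts "N_basis S ar" cutN degF "copN S ar :: _ \<Rightarrow> _ \<Rightarrow> 'k"
    by (rule connected_cuts_N)
  interpret K: connected_cuts "K_basis S ar" cutK degF "copK :: _ \<Rightarrow> _ \<Rightarrow> 'k"
    by (rule connected_cuts_K)
  let ?I = "kerR S ar :: ('s trm list \<Rightarrow> 'k) set"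
  let ?V = "vspace (N_basis S ar) :: ('s trm list \<Rightarrow> 'k) set"
  show "?I \<subseteq> ?V" by (auto simp: kerR_def)
  show "(\<lambda>_. 0) \<in> ?I" by (auto simp: kerR_iff vspace_def vsupp_def)
  show "\<exists>Sb :: _ \<Rightarrow> _ \<Rightarrow> 'k. is_antipode (N_basis S ar) (copN S ar) Sb"
    using N.is_antipode_antip by blast
  fix x assume x: "x \<in> ?I"
  then have xV: "x \<in> ?V" and xP: "Psi x = (\<lambda>_. 0)" by (auto simp: kerR_iff)
  show "x [] = 0" using Psi_counit[OF xV] xP by simp
  show "(\<lambda>z. x z + y z) \<in> ?I" if "y \<in> ?I" for y
  proof -
    have y: "y \<in> ?V" "Psi y = (\<lambda>_. 0)" using that by (auto simp: kerR_iff)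
    have "(\<lambda>z. x z + y z) \<in> ?V"
      by (rule vspaceI[of "vsupp x \<union> vsupp y"])
        (use xV y(1) in \<open>auto simp: vsupp_def vspace_def\<close>, metis add.right_neutral)
    moreover have "Psi (\<lambda>z. x z + y z) = (\<lambda>_. 0)"
      using vspaceD(1)[OF xV] vspaceD(1)[OF y(1)] xP y(2) by (auto simp: Psi_def lext_add fun_eq_iff)
    ultimately show ?thesis by (simp add: kerR_iff)
  qed
  show "(\<lambda>z. c * x z) \<in> ?I" for c
  proof -
    have "(\<lambda>z. c * x z) \<in> ?V"
      by (rule vspaceI[of "vsupp x"]) (use xV in \<open>auto simp: vsupp_def vspace_def\<close>, metis mult_zero_right)
    moreover have "Psi (\<lambda>z. c * x z) = (\<lambda>_. 0)"
      using vspaceD(1)[OF xV] xP by (auto simp: Psi_def lext_scale fun_eq_iff)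
    ultimately show ?thesis by (simp add: kerR_iff)
  qed
  show "cat_mul a x \<in> ?I" "cat_mul x a \<in> ?I" if a: "a \<in> ?V" for a
  proof -
    have "cat_mul u (\<lambda>_. 0) = (\<lambda>_. 0)" "cat_mul (\<lambda>_. 0) u = (\<lambda>_. 0)" for u :: "'s trm list \<Rightarrow> 'k"
      by (simp_all add: cat_mul_def) (simp add: lext_def)
    then show "cat_mul a x \<in> ?I" "cat_mul x a \<in> ?I"
      using cat_mul_vspace[OF a xV N_basis_append] cat_mul_vspace[OF xV a N_basis_append]
        Psi_cat_mul[OF vspaceD(1)[OF a] vspaceD(1)[OF xV]] Psi_cat_mul[OF vspaceD(1)[OF xV] vspaceD(1)[OF a]] xP
      by (simp_all add: kerR_iff)
  qed
  show "in_span ({tensor a b |a b. a \<in> ?I \<and> b \<in> ?V} \<union> {tensor a b |a b. a \<in> ?V \<and> b \<in> ?I}) (lext (copN S ar) x)"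
  proof (rule kernel_tensor_in_span)
    show "lext (copN S ar) x \<in> vspace (\<lambda>(a, b). N_basis S ar a \<and> N_basis S ar b)"
    proof (rule lext_vspace[OF xV])
      fix f assume f: "N_basis S ar f"
      have "case p of (a, b) \<Rightarrow> N_basis S ar a \<and> N_basis S ar b" if "p \<in> set (cutN f)" for p
        using N.closed[OF f, of "fst p" "snd p"] that by (simp add: case_prod_unfold)
      then show "(copN S ar f :: _ \<Rightarrow> 'k) \<in> vspace (\<lambda>(a, b). N_basis S ar a \<and> N_basis S ar b)"
        unfolding copN_eq[OF f] by (rule lvec_vspace)
    qed
    show "lext (\<lambda>(a, b). bvec (trF a, trF b)) (lext (copN S ar) x) = (\<lambda>_. 0)"
      using Psi_cop[OF xV] xP by simp
  qed
  \<comment> \<open>Stability is required for every antipode \<open>Sb\<close>, so it is compared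
    with one fixed antipode of the target, through which \<open>Psi (lext Sb x)\<close> becomes the
    image of \<open>Psi x = 0\<close>.\<close>
  show "lext Sb x \<in> ?I" if Sb: "is_antipode (N_basis S ar) (copN S ar) Sb" for Sb
  proof -
    have "lext Sb x \<in> ?V"
      using xV by (rule lext_vspace) (use Sb in \<open>auto simp: is_antipode_def\<close>)
    moreover have "Psi (lext Sb x) = (\<lambda>_. 0)"
      using Psi_lext_antipode[OF Sb K.is_antipode_antip xV] xP by simp
    ultimately show ?thesis by (simp add: kerR_iff)
  qed
qed

text \<open>The quotient is not formed: an isomorphism from it sending the class of
  \<open>E_f\<close> to \<open>E_tr(f)\<close> amounts to a surjective Hopf algebra morphism
  \<open>Psi\<close> whose kernel is exactly \<open>kerR\<close>. Equality with the kernel gives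
  well-definedness in one direction and injectivity in the other. Existence of an antipode on terms
  is contained in \<open>hopf_ideal\<close>.\<close>

theorem theorem5p5:
  fixes S :: "'s set" and ar :: "'s \<Rightarrow> nat"
  shows "hopf_ideal (N_basis S ar) (copN S ar) (kerR S ar :: ('s trm list \<Rightarrow> 'k::field_char_0) set)
    \<and> (\<forall>v::'s trm list \<Rightarrow> 'k. v \<in> vspace (N_basis S ar) \<longrightarrow> Psi v \<in> vspace (K_basis S ar))
    \<and> (\<forall>v::'s trm list \<Rightarrow> 'k. v \<in> vspace (N_basis S ar) \<longrightarrow> (Psi v = (\<lambda>_. 0) \<longleftrightarrow> v \<in> kerR S ar))
    \<and> (\<forall>u::'s trm list \<Rightarrow> 'k. u \<in> vspace (K_basis S ar) \<longrightarrow> (\<exists>v\<in>vspace (N_basis S ar). Psi v = u))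
    \<and> (\<forall>v w::'s trm list \<Rightarrow> 'k. v \<in> vspace (N_basis S ar) \<longrightarrow> w \<in> vspace (N_basis S ar) \<longrightarrow>
          Psi (cat_mul v w) = cat_mul (Psi v) (Psi w))
    \<and> Psi (bvec [] :: 's trm list \<Rightarrow> 'k) = bvec []
    \<and> (\<forall>v::'s trm list \<Rightarrow> 'k. v \<in> vspace (N_basis S ar) \<longrightarrow> Psi v [] = v [])
    \<and> (\<forall>v::'s trm list \<Rightarrow> 'k. v \<in> vspace (N_basis S ar) \<longrightarrow>
          lext copK (Psi v) = lext (\<lambda>(a, b). bvec (trF a, trF b)) (lext (copN S ar) v))
    \<and> (\<exists>Sb::'s trm list \<Rightarrow> 's trm list \<Rightarrow> 'k. is_antipode (K_basis S ar) copK Sb)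
    \<and> (\<forall>(S1::'s trm list \<Rightarrow> 's trm list \<Rightarrow> 'k) S2. is_antipode (N_basis S ar) (copN S ar) S1 \<longrightarrow>
          is_antipode (K_basis S ar) copK S2 \<longrightarrow>
          (\<forall>v. v \<in> vspace (N_basis S ar) \<longrightarrow> Psi (lext S1 v) = lext S2 (Psi v)))"
proof (intro conjI allI impI)
  show "\<exists>Sb::'s trm list \<Rightarrow> 's trm list \<Rightarrow> 'k. is_antipode (K_basis S ar) copK Sb"
    using connected_cuts.is_antipode_antip[OF connected_cuts_K] by blast
qed (simp_all add: hopf_ideal_kerR Psi_vspace kerR_iff Psi_surj Psi_cat_mul vspaceD(1) Psi_counit Psi_cop
    Psi_lext_antipode)

end
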